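(* Let $T$ be an interval exchange map of $d\ge 2$ intervals with admissible combinatorial data, with the Keane property, and with total length $\lambda^*=1$. Suppose that for every $\varepsilon>0$ there is $C_\varepsilon>0$ such that $\|A(k,k+1)\|\le C_\varepsilon\|A(k)\|^{\varepsilon}$ for all $k\ge 1$ (Condition (A)). Then for every $\varepsilon>0$ there is $C'_\varepsilon>0$ such that $\Delta(T^n)\ge C'_\varepsilon\, n^{-(1+\varepsilon)}$ for all $n\ge 1$ (Condition (D)).
   Context: Interval exchange maps. Let $\mathcal A$ be an alphabet with $d\ge2$ letters. Combinatorial data is a pair $\pi=(\pi_t,\pi_b)$ of bijections $\mathcal A\to\{1,\dots,d\}$; it is admissible if $\pi_t^{-1}(\{1,\dots,k\})\ne\pi_b^{-1}(\{1,\dots,k\})$ for $k=1,\dots,d-1$. Length data is a vector $(\lambda_\alpha)_{\alpha\in\mathcal A}$ of positive reals; $\lambda^*=\sum_\alpha\lambda_\alpha$, $I=[0,\lambda^* )$, $p_\alpha=\sum_{\pi_t(\beta)<\pi_t(\alpha)}\lambda_\beta$, $I_\alpha=[p_\alpha,p_\alpha+\lambda_\alpha)$. The map is $T(x)=x+\sum_{\pi_b(\beta)<\pi_b(\alpha)}\lambda_\beta-\sum_{\pi_t(\beta)<\pi_t(\alpha)}\lambda_\beta$ for $x\in I_\alpha$. Keane property: there are no $\alpha,\beta\in\mathcal A$ and $m\ge1$ with $T^m(p_\alpha)=p_\beta$ and $\pi_t(\beta)>1$. Rauzy–Veech algorithm. Let $\alpha_t,\alpha_b$ be the letters with $\pi_t(\alpha_t)=\pi_b(\alpha_b)=d$.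 If $\lambda_{\alpha_t}>\lambda_{\alpha_b}$ (top type) the winner is $\alpha_t$ and the loser $\alpha_b$; the new data keep $\pi_t$, and in the order given by $\pi_b$ the letter $\alpha_b$ is moved to the position immediately after $\alpha_t$. If $\lambda_{\alpha_b}>\lambda_{\alpha_t}$ (bottom type) the winner is $\alpha_b$ and the loser $\alpha_t$; the new data keep $\pi_b$, and in the order given by $\pi_t$ the letter $\alpha_t$ is moved to the position immediately after $\alpha_b$. In both cases the winner's length is replaced by (winner's length minus loser's length) and all other lengths are kept. The new map $\mathcal V(T)$ is the first return map of $T$ to $[0,\sum_\alpha\hat\lambda_\alpha)$, where $\hat\lambda$ is the new length vector. For $T$ admissible with the Keane property this can be iterated forever; $T(n)=\mathcal V^n(T)$ has data $\pi^{(n)},\lambda(n)$ and total length $\lambda^*(n)$. Write $\gamma(m,n)$ for the sequence of steps (arrows) from $T(m)$ to $T(n)$. For a step with winner $\alpha$ and loser $\beta$ put $B=\mathbb I+E_{\beta\alpha}$ ($E_{\beta\alpha}$ has its only nonzero entry, a $1$, in row $\beta$, column $\alpha$); $Q(m,n)$ is the product of the matrices of the steps of $\gamma(m,n)$, later steps on the left, and $Q(n)=Q(0,n)$. The norm $\|\cdot\|$ of a matrix is the sum of the absolute values of its entries. Marmi–Moussa–Yoccoz acceleration. $m_0=0$ and $m_{k+1}>m_k$ is the largest integer such that not all letters of $\mathcal A$ are winners of steps in $\gamma(m_k,m_{k+1})$. $A(k)=Q(0,m_k)$, $A(k,\ell)=Q(m_k,m_\ell)$. Discontinuities. $D(T)=\{p_\alpha:\pi_t(\alpha)>1\}$,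 $D(T^n)=\bigcup_{i=0}^{n-1}T^{-i}(D(T))$, and $\Delta(T^n)$ is the minimum distance between distinct points of $D(T^n)\cup\{0,1\}$. *)

theory Defs
  imports "HOL-Analysis.Analysis"
begin

text \<open>
  The alphabet is a finite type \<open>'a\<close> and \<open>d = CARD('a)\<close>. An interval exchange map is
  represented by its data: the position \<open>top_pos\<close> of each letter in the domain order, its
  position \<open>bot_pos\<close> in the image order (both counted from 1), and the lengths.
\<close>

datatype 'a iet =
  IET (top_pos: "'a \<Rightarrow> nat") (bot_pos: "'a \<Rightarrow> nat") (len: "'a \<Rightarrow> real")

definition is_iet :: "'a::finite iet \<Rightarrow> bool" where
  "is_iet T \<longleftrightarrow>
     bij_betw (top_pos T) UNIV {1..CARD('a)} \<and>
     bij_betw (bot_pos T) UNIV {1..CARD('a)} \<and>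
     (\<forall>\<alpha>. len T \<alpha> > 0)"

definition admissible :: "'a::finite iet \<Rightarrow> bool" where
  "admissible T \<longleftrightarrow>
     (\<forall>k\<in>{1..CARD('a) - 1}. top_pos T -` {1..k} \<noteq> bot_pos T -` {1..k})"

definition total_length :: "'a::finite iet \<Rightarrow> real" where
  "total_length T = (\<Sum>\<alpha>\<in>UNIV. len T \<alpha>)"

definition iet_domain :: "'a::finite iet \<Rightarrow> real set" where
  "iet_domain T = {0..<total_length T}"

definition left_end :: "'a::finite iet \<Rightarrow> 'a \<Rightarrow> real" where
  "left_end T \<alpha> = (\<Sum>\<beta> | top_pos T \<beta> < top_pos T \<alpha>. len T \<beta>)"

definition image_left_end :: "'a::finite iet \<Rightarrow> 'a \<Rightarrow> real" where
  "image_left_end T \<alpha> = (\<Sum>\<beta> | bot_pos T \<beta> < bot_pos T \<alpha>. len T \<beta>)"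

definition subinterval :: "'a::finite iet \<Rightarrow> 'a \<Rightarrow> real set" where
  "subinterval T \<alpha> = {left_end T \<alpha>..<left_end T \<alpha> + len T \<alpha>}"

text \<open>Only the values of \<open>iet_map T\<close> on \<open>iet_domain T\<close> are meaningful.\<close>

definition iet_map :: "'a::finite iet \<Rightarrow> real \<Rightarrow> real" where
  "iet_map T x =
     (let \<alpha> = (THE \<alpha>. x \<in> subinterval T \<alpha>) in x + image_left_end T \<alpha> - left_end T \<alpha>)"

definition keane :: "'a::finite iet \<Rightarrow> bool" where
  "keane T \<longleftrightarrow>
     \<not> (\<exists>\<alpha> \<beta>. \<exists>m\<ge>1. (iet_map T ^^ m) (left_end T \<alpha>) = left_end T \<beta> \<and> top_pos T \<beta> > 1)"

subsection \<open>The Rauzy--Veech algorithm\<close>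

definition last_top :: "'a::finite iet \<Rightarrow> 'a" where
  "last_top T = (THE \<alpha>. top_pos T \<alpha> = CARD('a))"

definition last_bot :: "'a::finite iet \<Rightarrow> 'a" where
  "last_bot T = (THE \<alpha>. bot_pos T \<alpha> = CARD('a))"

text \<open>
  A tie between the two last lengths is never met under the Keane property; the
  definitions below treat it as bottom type.
\<close>

definition top_type :: "'a::finite iet \<Rightarrow> bool" where
  "top_type T \<longleftrightarrow> len T (last_top T) > len T (last_bot T)"

definition winner :: "'a::finite iet \<Rightarrow> 'a" where
  "winner T = (if top_type T then last_top T else last_bot T)"

definition loser :: "'a::finite iet \<Rightarrow> 'a" where
  "loser T = (if top_type T then last_bot T else last_top T)"

text \<open>
  In the order given by \<open>p\<close>, move the letter \<open>\<beta>\<close>, assumed to be the last one, to the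
  position immediately after \<open>\<alpha>\<close>.
\<close>

definition move_last_after :: "('a \<Rightarrow> nat) \<Rightarrow> 'a \<Rightarrow> 'a \<Rightarrow> 'a \<Rightarrow> nat" where
  "move_last_after p \<beta> \<alpha> \<gamma> =
     (if p \<gamma> \<le> p \<alpha> then p \<gamma> else if \<gamma> = \<beta> then p \<alpha> + 1 else p \<gamma> + 1)"

definition rauzy_veech :: "'a::finite iet \<Rightarrow> 'a iet" where
  "rauzy_veech T =
     IET (if top_type T then top_pos T else move_last_after (top_pos T) (loser T) (winner T))
         (if top_type T then move_last_after (bot_pos T) (loser T) (winner T) else bot_pos T)
         ((len T)(winner T := len T (winner T) - len T (loser T)))"

definition rv_iter :: "'a::finite iet \<Rightarrow> nat \<Rightarrow> 'a iet" where
  "rv_iter T n = (rauzy_veech ^^ n) T"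

definition step_matrix :: "'a::finite iet \<Rightarrow> real ^ 'a ^ 'a" where
  "step_matrix T =
     mat 1 + (\<chi> i j. if i = loser T \<and> j = winner T then 1 else 0)"

text \<open>
  \<open>Q_mat T m n\<close> is the product of the matrices of the steps \<open>m, \<dots>, n - 1\<close> (step \<open>j\<close> goes
  from \<open>rv_iter T j\<close> to \<open>rv_iter T (j + 1)\<close>), later steps on the left.
\<close>

fun Q_mat :: "'a::finite iet \<Rightarrow> nat \<Rightarrow> nat \<Rightarrow> real ^ 'a ^ 'a" where
  "Q_mat T m 0 = mat 1"
| "Q_mat T m (Suc n) = (if m \<le> n then step_matrix (rv_iter T n) ** Q_mat T m n else mat 1)"

definition matrix_norm1 :: "real ^ 'a ^ 'a \<Rightarrow> real" where
  "matrix_norm1 M = (\<Sum>i\<in>UNIV. \<Sum>j\<in>UNIV. \<bar>M $ i $ j\<bar>)"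

subsection \<open>The Marmi--Moussa--Yoccoz acceleration\<close>

definition winners_between :: "'a::finite iet \<Rightarrow> nat \<Rightarrow> nat \<Rightarrow> 'a set" where
  "winners_between T m n = (\<lambda>j. winner (rv_iter T j)) ` {m..<n}"

text \<open>
  The greatest element below exists when the Keane property holds and \<open>d \<ge> 2\<close>, since then
  every letter wins infinitely often.
\<close>

fun mmy_time :: "'a::finite iet \<Rightarrow> nat \<Rightarrow> nat" where
  "mmy_time T 0 = 0"
| "mmy_time T (Suc k) =
     (GREATEST n. n > mmy_time T k \<and> winners_between T (mmy_time T k) n \<noteq> UNIV)"

definition A_mat :: "'a::finite iet \<Rightarrow> nat \<Rightarrow> nat \<Rightarrow> real ^ 'a ^ 'a" where
  "A_mat T k l = Q_mat T (mmy_time T k) (mmy_time T l)"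

definition condition_A :: "'a::finite iet \<Rightarrow> bool" where
  "condition_A T \<longleftrightarrow>
     (\<forall>\<epsilon>>0. \<exists>C>0. \<forall>k\<ge>1.
        matrix_norm1 (A_mat T k (k + 1)) \<le> C * matrix_norm1 (Q_mat T 0 (mmy_time T k)) powr \<epsilon>)"

subsection \<open>Discontinuities\<close>

definition discont :: "'a::finite iet \<Rightarrow> real set" where
  "discont T = {left_end T \<alpha> | \<alpha>. top_pos T \<alpha> > 1}"

definition discont_iter :: "'a::finite iet \<Rightarrow> nat \<Rightarrow> real set" where
  "discont_iter T n = (\<Union>i<n. {x \<in> iet_domain T. (iet_map T ^^ i) x \<in> discont T})"

text \<open>The endpoints 0 and 1 are those of the domain when the total length is 1.\<close>

definition min_gap :: "'a::finite iet \<Rightarrow> nat \<Rightarrow> real" where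
  "min_gap T n =
     Min {dist x y | x y. x \<in> discont_iter T n \<union> {0, 1} \<and> y \<in> discont_iter T n \<union> {0, 1} \<and> x \<noteq> y}"

definition condition_D :: "'a::finite iet \<Rightarrow> bool" where
  "condition_D T \<longleftrightarrow>
     (\<forall>\<epsilon>>0. \<exists>C>0. \<forall>n\<ge>1. min_gap T n \<ge> C * real n powr (- (1 + \<epsilon>)))"

end

theory Submission imports Defs
begin

text \<open>
  Let \<open>T(N)\<close> be the map after \<open>N\<close> Rauzy--Veech steps and cut \<open>[0, 1)\<close> into the levels
  \<open>T\<^sup>j(I\<^sub>\<beta>(N))\<close>, \<open>0 \<le> j < height\<close>, of the Rokhlin towers over \<open>T(N)\<close>; the heights are the row
  sums of \<open>Q(N)\<close>. Every discontinuity of \<open>T\<close> is the left end of a level, and if all of them sit at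
  level at least \<open>n - 1\<close>, their first \<open>n\<close> preimages are again left ends of levels, so that
  \<open>\<Delta>(T\<^sup>n)\<close> is at least the shortest length in \<open>T(N)\<close>.

  The product of \<open>r = 4d\<close> consecutive matrices \<open>A(k, k + 1)\<close> is positive. If \<open>\<parallel>A(k)\<parallel> \<ge> n\<close>,
  positivity used three times shows that all heights at time \<open>k + r\<close> are at least \<open>n\<close>, that the
  discontinuities have the required levels at time \<open>k + 2r\<close>, and that every length at that time is
  at least the total length at time \<open>k + 3r\<close>, hence at least \<open>1 / \<parallel>A(k + 3r)\<parallel>\<close>. For the least such
  \<open>k\<close> we have \<open>\<parallel>A(k - 1)\<parallel> < n\<close>, and Condition (A), applied boundedly many times, gives
  \<open>\<parallel>A(k + 3r)\<parallel> \<le> C n\<^bsup>1 + \<epsilon>\<^esup>\<close>.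
\<close>

subsection \<open>One step of the Rauzy--Veech algorithm\<close>

text \<open>The order is a parameter because a step keeps one of the two orders and changes the
  other: the same computations then serve left ends and image left ends, and both step
  types.\<close>

definition offset :: "('a::finite \<Rightarrow> nat) \<Rightarrow> ('a \<Rightarrow> real) \<Rightarrow> 'a \<Rightarrow> real" where
  "offset p l \<alpha> = (\<Sum>\<beta> | p \<beta> < p \<alpha>. l \<beta>)"

lemma left_end_offset: "left_end T = offset (top_pos T) (len T)"
  by (simp add: fun_eq_iff left_end_def offset_def)

lemma image_left_end_offset: "image_left_end T = offset (bot_pos T) (len T)"
  by (simp add: fun_eq_iff image_left_end_def offset_def)

lemma position_bounds:
  assumes "bij_betw p UNIV {1..CARD('a::finite)}"
  shows "1 \<le> p (\<gamma>::'a)" "p \<gamma> \<le> CARD('a)"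
  using bij_betwE[OF assms] by auto

lemma offset_nonneg: "(\<And>\<beta>. l \<beta> > 0) \<Longrightarrow> offset p l \<alpha> \<ge> 0"
  unfolding offset_def by (intro sum_nonneg) (simp add: less_imp_le)

lemma offset_plus_eq: "inj p \<Longrightarrow> offset p l \<alpha> + l \<alpha> = (\<Sum>\<beta> | p \<beta> \<le> p \<alpha>. l \<beta>)"
proof -
  assume "inj p"
  then have "{\<beta>. p \<beta> \<le> p \<alpha>} = insert \<alpha> {\<beta>. p \<beta> < p \<alpha>}"
    by (auto simp: le_less dest: injD)
  then show ?thesis
    by (simp add: offset_def)
qed

lemma offset_less:
  assumes "inj p" "\<And>\<beta>. l \<beta> > 0" "p \<alpha> < p \<beta>"
  shows "offset p l \<alpha> + l \<alpha> \<le> offset p l \<beta>"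
  unfolding offset_plus_eq[OF assms(1)] unfolding offset_def
  using assms by (intro sum_mono2) (auto simp: less_imp_le)

lemma offset_plus_le_sum:
  assumes "inj p" "\<And>\<beta>. l \<beta> > 0"
  shows "offset p l \<alpha> + l \<alpha> \<le> sum l UNIV"
  unfolding offset_plus_eq[OF assms(1)]
  using assms by (intro sum_mono2) (auto simp: less_imp_le)

lemma offset_last:
  assumes "bij_betw p UNIV {1..CARD('a::finite)}" "p \<alpha> = CARD('a)"
  shows "offset p l (\<alpha>::'a) + l \<alpha> = sum l UNIV"
proof -
  have "inj p" "{\<beta>. p \<beta> \<le> p \<alpha>} = UNIV"
    using assms by (auto simp: bij_betw_def)
  then show ?thesis
    by (simp add: offset_plus_eq)
qed

lemma offset_first:
  assumes "bij_betw p UNIV {1..CARD('a::finite)}" "p (\<alpha>::'a) = 1"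
  shows "offset p l \<alpha> = 0"
proof -
  have "{\<beta>. p \<beta> < p \<alpha>} = {}"
    using position_bounds(1)[OF assms(1)] assms(2) by (metis (no_types, lifting) Collect_empty_eq linorder_not_le)
  then show ?thesis by (simp only: offset_def sum.empty)
qed

text \<open>Among the letters with offset at most \<open>x\<close>, the one of largest position
  works: its right end is the offset of the next letter, or the total length.\<close>

lemma offset_cover:
  assumes p: "bij_betw p UNIV {1..CARD('a::finite)}" and l: "\<And>\<beta>. l \<beta> > 0"
    and x: "0 \<le> x" "x < sum l UNIV"
  shows "\<exists>\<alpha>::'a. offset p l \<alpha> \<le> x \<and> x < offset p l \<alpha> + l \<alpha>"
proof -
  have inj: "inj p" and ran: "range p = {1..CARD('a)}"
    using p by (auto simp: bij_betw_def)
  have "1 \<in> range p"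
    by (simp add: ran Suc_leI)
  then obtain \<beta> where "p \<beta> = 1"
    by auto
  then have *: "\<beta> \<in> {\<alpha>. offset p l \<alpha> \<le> x}"
    using offset_first[OF p] x by simp
  define M where "M = Max (p ` {\<alpha>. offset p l \<alpha> \<le> x})"
  have "M \<in> p ` {\<alpha>. offset p l \<alpha> \<le> x}"
    unfolding M_def using * by (intro Max_in) auto
  then obtain \<alpha> where \<alpha>: "offset p l \<alpha> \<le> x" "p \<alpha> = M"
    by auto
  have max: "p \<gamma> \<le> M" if "offset p l \<gamma> \<le> x" for \<gamma>
    unfolding M_def using that by (intro Max_ge) auto
  have "x < offset p l \<alpha> + l \<alpha>"
  proof (cases "M = CARD('a)")
    case True
    then show ?thesis using offset_last[OF p, of \<alpha> l] \<alpha> x by simp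
  next
    case False
    have "M \<in> {1..CARD('a)}"
      using \<alpha> ran by auto
    with False have "Suc M \<in> range p"
      unfolding ran by simp
    then obtain \<gamma> where \<gamma>: "p \<gamma> = Suc M"
      by auto
    have "offset p l \<gamma> = offset p l \<alpha> + l \<alpha>"
      unfolding offset_plus_eq[OF inj] unfolding offset_def \<gamma> \<alpha>(2) by (simp add: less_Suc_eq_le)
    then show ?thesis
      using max[of \<gamma>] \<gamma> by force
  qed
  then show ?thesis using \<alpha> by blast
qed

lemma offset_unique:
  assumes "inj p" "\<And>\<beta>. l \<beta> > 0"
    "offset p l \<alpha> \<le> x" "x < offset p l \<alpha> + l \<alpha>" "offset p l \<beta> \<le> x" "x < offset p l \<beta> + l \<beta>"
  shows "\<alpha> = \<beta>"
  using offset_less[of p l \<alpha> \<beta>] offset_less[of p l \<beta> \<alpha>] assms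
  by (metis injD less_le_trans linorder_not_le nat_neq_iff)

lemma move_last_after_bij:
  assumes p: "bij_betw p UNIV {1..CARD('a::finite)}" and "p \<beta> = CARD('a)" "\<alpha> \<noteq> (\<beta>::'a)"
  shows "bij_betw (move_last_after p \<beta> \<alpha>) UNIV {1..CARD('a)}"
proof -
  have inj: "inj p" and ran: "range p = {1..CARD('a)}"
    using p by (auto simp: bij_betw_def)
  have le: "1 \<le> p \<gamma>" "p \<gamma> \<le> CARD('a)" for \<gamma>
    using position_bounds[OF p] by auto
  have lt: "p \<gamma> < CARD('a)" if "\<gamma> \<noteq> \<beta>" for \<gamma>
    using that assms le[of \<gamma>] injD[OF inj, of \<gamma> \<beta>] by force
  have "inj (move_last_after p \<beta> \<alpha>)"
    unfolding move_last_after_def using injD[OF inj]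
    by (intro injI) (force split: if_splits)
  moreover have "range (move_last_after p \<beta> \<alpha>) \<subseteq> {1..CARD('a)}"
    using le lt assms(3) by (auto simp: move_last_after_def Suc_leI)
  ultimately show ?thesis
    by (simp add: bij_betw_def card_image card_subset_eq)
qed

text \<open>For the order kept by a step: the winner is last there, so its length enters no
  offset.\<close>

lemma offset_update_last:
  assumes "bij_betw p UNIV {1..CARD('a::finite)}" "p w = CARD('a)"
  shows "offset p (l(w := v)) (\<gamma>::'a) = offset p l \<gamma>"
  unfolding offset_def
proof (intro sum.cong refl)
  fix \<beta> assume "\<beta> \<in> {\<beta>. p \<beta> < p \<gamma>}"
  moreover have "p \<gamma> \<le> CARD('a)"
    using position_bounds[OF assms(1)] by simp
  ultimately show "(l(w := v)) \<beta> = l \<beta>"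
    using assms(2) by auto
qed

text \<open>For the order changed by a step: letters behind the winner now also count the loser,
  which cancels the amount subtracted from the winner's length. Only the loser's own offset
  changes.\<close>

lemma offset_move_last:
  assumes p: "bij_betw p UNIV {1..CARD('a::finite)}" and lo: "p lo = CARD('a)" "w \<noteq> lo"
  shows "offset (move_last_after p lo w) (l(w := l w - l lo)) (\<gamma>::'a) =
    (if \<gamma> = lo then offset p l w + l w - l lo else offset p l \<gamma>)"
proof -
  have inj: "inj p" and ran: "range p = {1..CARD('a)}"
    using p by (auto simp: bij_betw_def)
  have lt: "p \<gamma> < p lo" if "\<gamma> \<noteq> lo" for \<gamma>
  proof -
    have "p \<gamma> \<le> p lo" using position_bounds[OF p] lo by simp
    then show ?thesis using that injD[OF inj, of \<gamma> lo] by fastforce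
  qed
  let ?l = "l(w := l w - l lo)" and ?p = "move_last_after p lo w"
  consider "\<gamma> = lo" | "\<gamma> \<noteq> lo" "p \<gamma> \<le> p w" | "\<gamma> \<noteq> lo" "p \<gamma> > p w"
    by linarith
  then show ?thesis
  proof cases
    case 1
    have "{\<beta>. ?p \<beta> < ?p lo} = insert w {\<beta>. p \<beta> < p w}"
      using lt[of w] lo injD[OF inj, of _ w] by (auto simp: move_last_after_def le_less)
    then have "offset ?p ?l lo = ?l w + sum ?l {\<beta>. p \<beta> < p w}"
      by (simp add: offset_def)
    also have "sum ?l {\<beta>. p \<beta> < p w} = offset p l w"
      unfolding offset_def by (intro sum.cong) auto
    finally show ?thesis by (simp add: 1 fun_upd_same del: fun_upd_apply)
  next
    case 2
    have "{\<beta>. ?p \<beta> < ?p \<gamma>} = {\<beta>. p \<beta> < p \<gamma>}"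
      using 2 lt[of w] lo by (auto simp: move_last_after_def)
    then have "offset ?p ?l \<gamma> = sum ?l {\<beta>. p \<beta> < p \<gamma>}"
      by (simp add: offset_def)
    also have "\<dots> = offset p l \<gamma>"
      unfolding offset_def using 2 by (intro sum.cong) auto
    finally show ?thesis using 2 by simp
  next
    case 3
    define A where "A = {\<beta>. p \<beta> < p \<gamma>} - {w}"
    have "{\<beta>. ?p \<beta> < ?p \<gamma>} = insert lo (insert w A)"
      using 3 lt[of w] lt[of \<gamma>] lo by (auto simp: move_last_after_def A_def)
    moreover have "w \<notin> A" "lo \<notin> A"
      using lt[of \<gamma>] 3 by (auto simp: A_def)
    ultimately have "offset ?p ?l \<gamma> = l w + sum ?l ({\<beta>. p \<beta> < p \<gamma>} - {w})"
      using lo(2) by (simp add: offset_def flip: A_def)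
    also have "sum ?l ({\<beta>. p \<beta> < p \<gamma>} - {w}) = sum l ({\<beta>. p \<beta> < p \<gamma>} - {w})"
      by (intro sum.cong) auto
    also have "l w + \<dots> = offset p l \<gamma>"
      unfolding offset_def using 3 by (subst (2) sum.remove[of _ w]) auto
    finally show ?thesis using 3 by (simp del: fun_upd_apply)
  qed
qed

section \<open>Elementary properties of interval exchange maps\<close>

lemma is_ietD:
  assumes "is_iet T"
  shows "bij_betw (top_pos T) UNIV {1..CARD('a)}" "bij_betw (bot_pos T) UNIV {1..CARD('a::finite)}"
    "len T (\<alpha>::'a) > 0" "inj (top_pos T)" "inj (bot_pos T)"
  using assms by (auto simp: is_iet_def bij_betw_def)

lemma top_pos_last_top:
  assumes "is_iet (T :: 'a::finite iet)" shows "top_pos T (last_top T) = CARD('a)"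
proof -
  have "CARD('a) \<in> range (top_pos T)"
    using is_ietD(1)[OF assms] by (simp add: bij_betw_def Suc_leI)
  then obtain \<alpha> where \<alpha>: "top_pos T \<alpha> = CARD('a)"
    by (metis imageE)
  moreover have "\<beta> = \<alpha>" if "top_pos T \<beta> = CARD('a)" for \<beta>
    using that \<alpha> injD[OF is_ietD(4)[OF assms], of \<beta> \<alpha>] by metis
  ultimately show ?thesis
    unfolding last_top_def by (rule theI)
qed

lemma bot_pos_last_bot:
  assumes "is_iet (T :: 'a::finite iet)" shows "bot_pos T (last_bot T) = CARD('a)"
proof -
  have "CARD('a) \<in> range (bot_pos T)"
    using is_ietD(2)[OF assms] by (simp add: bij_betw_def Suc_leI)
  then obtain \<alpha> where \<alpha>: "bot_pos T \<alpha> = CARD('a)"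
    by (metis imageE)
  moreover have "\<beta> = \<alpha>" if "bot_pos T \<beta> = CARD('a)" for \<beta>
    using that \<alpha> injD[OF is_ietD(5)[OF assms], of \<beta> \<alpha>] by metis
  ultimately show ?thesis
    unfolding last_bot_def by (rule theI)
qed

lemma total_length_pos: "is_iet T \<Longrightarrow> total_length T > 0"
  unfolding total_length_def by (intro sum_pos) (auto simp: is_iet_def)

lemma subinterval_unique:
  "\<lbrakk>is_iet T; x \<in> subinterval T \<alpha>; x \<in> subinterval T \<beta>\<rbrakk> \<Longrightarrow> \<alpha> = \<beta>"
  using offset_unique[of "top_pos T" "len T" \<alpha> x \<beta>]
  by (auto simp: subinterval_def left_end_offset is_ietD)

lemma iet_map_eq:
  assumes "is_iet T" "x \<in> subinterval T \<alpha>"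
  shows "iet_map T x = x + image_left_end T \<alpha> - left_end T \<alpha>"
proof -
  have "(THE \<alpha>. x \<in> subinterval T \<alpha>) = \<alpha>"
    using assms subinterval_unique by (intro the_equality) auto
  then show ?thesis
    by (simp add: iet_map_def)
qed

lemma subinterval_subset_domain: "is_iet T \<Longrightarrow> subinterval T \<alpha> \<subseteq> iet_domain T"
  using offset_nonneg[of "len T" "top_pos T" \<alpha>] offset_plus_le_sum[of "top_pos T" "len T" \<alpha>]
  by (auto simp: subinterval_def iet_domain_def left_end_offset is_ietD total_length_def)

lemma domain_cover:
  assumes "is_iet T" "x \<in> iet_domain T"
  obtains \<alpha> where "x \<in> subinterval T \<alpha>"
  using offset_cover[of "top_pos T" "len T" x, OF is_ietD(1,3)[OF assms(1)]] assms(2)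
  by (auto simp: subinterval_def iet_domain_def left_end_offset total_length_def)

lemma left_end_in_subinterval: "is_iet T \<Longrightarrow> left_end T \<alpha> \<in> subinterval T \<alpha>"
  by (simp add: subinterval_def is_ietD)

lemma left_end_in_domain: "is_iet T \<Longrightarrow> left_end T \<alpha> \<in> iet_domain T"
  using left_end_in_subinterval subinterval_subset_domain by blast

lemma iet_map_in_image:
  assumes "is_iet T" "x \<in> subinterval T \<alpha>"
  shows "iet_map T x \<in> {image_left_end T \<alpha>..<image_left_end T \<alpha> + len T \<alpha>}"
  using assms by (auto simp: iet_map_eq subinterval_def)

lemma iet_map_in_domain:
  assumes "is_iet T" "x \<in> iet_domain T"
  shows "iet_map T x \<in> iet_domain T"
proof -
  obtain \<alpha> where "x \<in> subinterval T \<alpha>"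
    using assms domain_cover by blast
  then have "iet_map T x \<in> {image_left_end T \<alpha>..<image_left_end T \<alpha> + len T \<alpha>}"
    using assms(1) by (rule iet_map_in_image[rotated])
  then show ?thesis
    using offset_nonneg[of "len T" "bot_pos T" \<alpha>] offset_plus_le_sum[of "bot_pos T" "len T" \<alpha>] assms
    by (auto simp: iet_domain_def image_left_end_offset is_ietD total_length_def)
qed

lemma iet_map_inj:
  assumes T: "is_iet T"
  shows "inj_on (iet_map T) (iet_domain T)"
proof (rule inj_onI)
  fix x y assume xy: "x \<in> iet_domain T" "y \<in> iet_domain T" "iet_map T x = iet_map T y"
  obtain \<alpha> \<beta> where *: "x \<in> subinterval T \<alpha>" "y \<in> subinterval T \<beta>"
    using domain_cover[OF T] xy by metis
  have "\<alpha> = \<beta>"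
    using iet_map_in_image[OF T *(1)] iet_map_in_image[OF T *(2)] xy(3) is_ietD[OF T]
    by (intro offset_unique[of "bot_pos T" "len T" \<alpha> "iet_map T x"]) (auto simp: image_left_end_offset)
  then show "x = y"
    using * xy(3) iet_map_eq[OF T] by simp
qed

lemma funpow_in_domain:
  "\<lbrakk>is_iet T; x \<in> iet_domain T\<rbrakk> \<Longrightarrow> (iet_map T ^^ i) x \<in> iet_domain T"
  by (induction i) (auto intro: iet_map_in_domain)

lemma funpow_inj:
  assumes "is_iet T" "x \<in> iet_domain T" "y \<in> iet_domain T" "(iet_map T ^^ i) x = (iet_map T ^^ i) y"
  shows "x = y"
  using assms(4)
proof (induction i)
  case (Suc i)
  then show ?case
    using inj_onD[OF iet_map_inj[OF assms(1)]] funpow_in_domain[OF assms(1)] assms(2,3) by simp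
qed simp

text \<open>A letter last in both orders would leave the other \<open>CARD('a) - 1\<close> letters
  as a common initial segment.\<close>

lemma last_top_neq_last_bot:
  assumes "is_iet (T :: 'a::finite iet)" "CARD('a) \<ge> 2" "admissible T"
  shows "last_top T \<noteq> last_bot T"
proof
  assume eq: "last_top T = last_bot T"
  have *: "p -` {1..CARD('a) - 1} = UNIV - {\<alpha>}"
    if "bij_betw p UNIV {1..CARD('a)}" "p \<alpha> = CARD('a)" for p :: "'a \<Rightarrow> nat" and \<alpha>
  proof -
    have "inj p" "\<And>\<gamma>. p \<gamma> \<in> {1..CARD('a)}"
      using that by (auto simp: bij_betw_def)
    moreover have "p \<gamma> < CARD('a)" if "\<gamma> \<noteq> \<alpha>" for \<gamma>
      using that \<open>p \<alpha> = CARD('a)\<close> calculation(2)[of \<gamma>] injD[OF \<open>inj p\<close>, of \<gamma> \<alpha>] by fastforce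
    ultimately show ?thesis
      using that(2) by (auto simp: less_eq_Suc_le) fastforce+
  qed
  have "top_pos T -` {1..CARD('a) - 1} = bot_pos T -` {1..CARD('a) - 1}"
    using *[of "top_pos T" "last_top T"] *[of "bot_pos T" "last_bot T"] eq is_ietD[OF assms(1)]
      top_pos_last_top bot_pos_last_bot assms(1) by metis
  then show False
    using assms(2,3) by (auto simp: admissible_def)
qed

text \<open>The hypotheses that every step preserves, bundled for inductions along the
  algorithm.\<close>

definition keane_iet :: "'a::finite iet \<Rightarrow> bool" where
  "keane_iet T \<longleftrightarrow> CARD('a) \<ge> 2 \<and> is_iet T \<and> admissible T \<and> keane T"

lemma keane_ietD:
  assumes "keane_iet (T :: 'a::finite iet)"
  shows "CARD('a) \<ge> 2" "is_iet T" "admissible T" "keane T"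
  using assms by (auto simp: keane_iet_def)

lemma left_end_last_top: "is_iet T \<Longrightarrow> left_end T (last_top T) = total_length T - len T (last_top T)"
  using offset_last[OF is_ietD(1) top_pos_last_top, of T "len T"]
  by (simp add: left_end_offset total_length_def)

lemma image_left_end_last_bot:
  "is_iet T \<Longrightarrow> image_left_end T (last_bot T) = total_length T - len T (last_bot T)"
  using offset_last[OF is_ietD(2) bot_pos_last_bot, of T "len T"]
  by (simp add: image_left_end_offset total_length_def)

text \<open>Under a tie \<open>T\<close> would send the left end of the last bottom interval to that
  of the last top interval, against the Keane property with \<open>m = 1\<close>.\<close>

lemma last_len_neq:
  assumes "keane_iet (T :: 'a::finite iet)"
  shows "len T (last_top T) \<noteq> len T (last_bot T)"
proof
  note T = keane_ietD[OF assms]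
  assume "len T (last_top T) = len T (last_bot T)"
  then have "iet_map T (left_end T (last_bot T)) = left_end T (last_top T)"
    using T by (simp add: iet_map_eq[OF _ left_end_in_subinterval] left_end_last_top image_left_end_last_bot)
  then have "(iet_map T ^^ 1) (left_end T (last_bot T)) = left_end T (last_top T)"
    by simp
  moreover have "top_pos T (last_top T) > 1"
    using top_pos_last_top T by fastforce
  ultimately show False
    using T(4) unfolding keane_def by blast
qed

lemma winner_neq_loser: "keane_iet T \<Longrightarrow> winner T \<noteq> loser T"
  using last_top_neq_last_bot[of T] by (auto simp: keane_ietD winner_def loser_def)

lemma len_loser_less: "keane_iet T \<Longrightarrow> len T (loser T) < len T (winner T)"
  using last_len_neq[of T] by (auto simp: winner_def loser_def top_type_def)

section \<open>The data after one step\<close>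

lemma len_rauzy_veech:
  "len (rauzy_veech T) = (len T)(winner T := len T (winner T) - len T (loser T))"
  by (simp add: rauzy_veech_def)

lemma total_length_rauzy_veech:
  "total_length (rauzy_veech T) = total_length T - len T (loser T)"
proof -
  have "sum f UNIV = f (winner T) + sum f (UNIV - {winner T})" for f :: "'a \<Rightarrow> real"
    by (simp add: sum.remove)
  note * = this[of "len (rauzy_veech T)"] this[of "len T"]
  have "sum (len (rauzy_veech T)) (UNIV - {winner T}) = sum (len T) (UNIV - {winner T})"
    by (intro sum.cong) (auto simp: len_rauzy_veech)
  with * show ?thesis
    by (simp add: total_length_def len_rauzy_veech)
qed

lemma is_iet_rauzy_veech:
  assumes "keane_iet T" shows "is_iet (rauzy_veech T)"
proof -
  have "len (rauzy_veech T) \<alpha> > 0" for \<alpha>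
    using is_ietD(3)[OF keane_ietD(2)[OF assms]] len_loser_less[OF assms] by (simp add: len_rauzy_veech)
  moreover have "top_pos (rauzy_veech T) = (if top_type T then top_pos T
      else move_last_after (top_pos T) (loser T) (winner T))"
    "bot_pos (rauzy_veech T) = (if top_type T then move_last_after (bot_pos T) (loser T) (winner T)
      else bot_pos T)"
    by (auto simp: rauzy_veech_def)
  ultimately show ?thesis
    using is_ietD(1,2)[OF keane_ietD(2)[OF assms]]
      move_last_after_bij[OF _ _ winner_neq_loser[OF assms], of "top_pos T"]
      move_last_after_bij[OF _ _ winner_neq_loser[OF assms], of "bot_pos T"]
      top_pos_last_top[OF keane_ietD(2)[OF assms]] bot_pos_last_bot[OF keane_ietD(2)[OF assms]]
    unfolding is_iet_def by (cases "top_type T") (simp_all add: loser_def)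
qed

lemma left_end_rauzy_veech:
  assumes "keane_iet T"
  shows "left_end (rauzy_veech T) \<gamma> =
    (if \<not> top_type T \<and> \<gamma> = loser T then left_end T (winner T) + len T (winner T) - len T (loser T)
     else left_end T \<gamma>)"
  using offset_move_last[of "top_pos T" "loser T" "winner T" "len T" \<gamma>]
    offset_update_last[of "top_pos T" "winner T" "len T"] winner_neq_loser[OF assms]
    is_ietD[OF keane_ietD(2)[OF assms]] top_pos_last_top[OF keane_ietD(2)[OF assms]]
  by (auto simp: left_end_offset rauzy_veech_def winner_def loser_def)

lemma image_left_end_rauzy_veech:
  assumes "keane_iet T"
  shows "image_left_end (rauzy_veech T) \<gamma> =
    (if top_type T \<and> \<gamma> = loser T then image_left_end T (winner T) + len T (winner T) - len T (loser T)
     else image_left_end T \<gamma>)"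
  using offset_move_last[of "bot_pos T" "loser T" "winner T" "len T" \<gamma>]
    offset_update_last[of "bot_pos T" "winner T" "len T"] winner_neq_loser[OF assms]
    is_ietD[OF keane_ietD(2)[OF assms]] bot_pos_last_bot[OF keane_ietD(2)[OF assms]]
  by (auto simp: image_left_end_offset rauzy_veech_def winner_def loser_def)

text \<open>The kept order has the winner last, so a common initial segment of the new orders omits
  the winner. It therefore ends before the place of insertion and was already common to the old
  orders.\<close>

lemma admissible_rauzy_veech:
  assumes "keane_iet (T :: 'a::finite iet)" shows "admissible (rauzy_veech T)"
proof -
  note T = keane_ietD[OF assms]
  \<comment> \<open>Here \<open>p\<close> is the order that changes and \<open>q\<close> the one
    that is kept.\<close>
  have *: "move_last_after p lo w -` {1..k} = p -` {1..k}"
    if "q -` {1..k} = move_last_after p lo w -` {1..k}" "q w > k"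
      "p lo > k" "bij_betw p UNIV {1..CARD('a)}" "k \<ge> 1"
    for p q :: "'a \<Rightarrow> nat" and lo w k
  proof -
    have ge: "p \<gamma> \<ge> 1" for \<gamma>
      using position_bounds[OF that(4)] by simp
    have "w \<notin> q -` {1..k}"
      using that(2) by simp
    then have "w \<notin> move_last_after p lo w -` {1..k}"
      unfolding that(1) .
    then have "p w > k"
      using ge[of w] by (simp add: move_last_after_def not_le)
    then show ?thesis
      using that(3) ge by (auto simp: move_last_after_def split: if_splits)
  qed
  show ?thesis
    unfolding admissible_def
  proof (intro ballI notI)
    fix k assume k: "k \<in> {1..CARD('a) - 1}"
      and eq: "top_pos (rauzy_veech T) -` {1..k} = bot_pos (rauzy_veech T) -` {1..k}"
    have "top_pos T -` {1..k} = bot_pos T -` {1..k}"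
      using eq k *[of "top_pos T" k "bot_pos T" "loser T" "winner T"]
        *[of "bot_pos T" k "top_pos T" "loser T" "winner T"] is_ietD[OF T(2)]
        top_pos_last_top[OF T(2)] bot_pos_last_bot[OF T(2)]
      by (auto simp: rauzy_veech_def winner_def loser_def split: if_splits)
    then show False
      using T(3) k by (auto simp: admissible_def)
  qed
qed

section \<open>The new map as a first return map\<close>

lemma subinterval_rauzy_veech_other:
  assumes "keane_iet T" "x \<in> subinterval (rauzy_veech T) \<alpha>" "\<alpha> \<noteq> loser T"
  shows "x \<in> subinterval T \<alpha>" "iet_map (rauzy_veech T) x = iet_map T x"
proof -
  note T = keane_ietD[OF assms(1)]
  show *: "x \<in> subinterval T \<alpha>"
    using assms(2,3) is_ietD(3)[OF T(2), of "loser T"]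
    by (auto simp: subinterval_def left_end_rauzy_veech[OF assms(1)] len_rauzy_veech split: if_splits)
  show "iet_map (rauzy_veech T) x = iet_map T x"
    using assms(3)
    by (simp add: iet_map_eq[OF T(2) *] iet_map_eq[OF is_iet_rauzy_veech[OF assms(1)] assms(2)]
      left_end_rauzy_veech[OF assms(1)] image_left_end_rauzy_veech[OF assms(1)])
qed

text \<open>Only the loser's new interval needs two steps to return. It starts inside the old
  interval of this letter (its own for top type, the right end of the winner's for bottom type) and
  then passes through that of \<open>second_visit\<close>.\<close>

definition first_visit :: "'a::finite iet \<Rightarrow> 'a" where
  "first_visit T = (if top_type T then loser T else winner T)"

definition second_visit :: "'a::finite iet \<Rightarrow> 'a" where
  "second_visit T = (if top_type T then winner T else loser T)"

text \<open>The step cuts off a final piece of the domain as long as the loser's interval. The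
  loser's new interval is mapped exactly onto this piece, so a second application of
  \<open>T\<close> is needed to return.\<close>

lemma subinterval_rauzy_veech_loser:
  assumes "keane_iet T" "x \<in> subinterval (rauzy_veech T) (loser T)"
  shows "x \<in> subinterval T (first_visit T)"
    "iet_map T x \<in> subinterval T (second_visit T)"
    "iet_map T x \<notin> iet_domain (rauzy_veech T)"
    "iet_map (rauzy_veech T) x = iet_map T (iet_map T x)"
proof -
  note T = keane_ietD[OF assms(1)]
  note simps = left_end_rauzy_veech[OF assms(1)] image_left_end_rauzy_veech[OF assms(1)] len_rauzy_veech
    first_visit_def second_visit_def
  note ends = left_end_last_top[OF T(2)] image_left_end_last_bot[OF T(2)]
    len_loser_less[OF assms(1)] is_ietD(3)[OF T(2)] winner_neq_loser[OF assms(1)]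
  show 1: "x \<in> subinterval T (first_visit T)"
    using assms(2) ends by (auto simp: subinterval_def simps)
  note eq1 = iet_map_eq[OF T(2) 1]
  show 2: "iet_map T x \<in> subinterval T (second_visit T)"
    using assms(2) ends unfolding eq1
    by (cases "top_type T") (auto simp: subinterval_def simps winner_def loser_def)
  show 3: "iet_map T x \<notin> iet_domain (rauzy_veech T)"
    using assms(2) ends unfolding eq1
    by (cases "top_type T") (auto simp: subinterval_def simps winner_def loser_def
      iet_domain_def total_length_rauzy_veech)
  note eq2 = iet_map_eq[OF T(2) 2] iet_map_eq[OF is_iet_rauzy_veech[OF assms(1)] assms(2)]
  show "iet_map (rauzy_veech T) x = iet_map T (iet_map T x)"
    using ends unfolding eq2 unfolding eq1
    by (cases "top_type T") (auto simp: subinterval_def simps winner_def loser_def)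
qed

lemma iet_map_left_end_rauzy_veech:
  assumes "keane_iet T" "\<not> top_type T"
  shows "iet_map T (left_end (rauzy_veech T) (loser T)) = left_end T (loser T)"
proof -
  note T = keane_ietD[OF assms(1)]
  have "left_end (rauzy_veech T) (loser T) \<in> subinterval T (first_visit T)"
    using subinterval_rauzy_veech_loser(1)[OF assms(1)] left_end_in_subinterval
      is_iet_rauzy_veech[OF assms(1)] by blast
  then show ?thesis
    using assms(2) left_end_last_top[OF T(2)] image_left_end_last_bot[OF T(2)]
    by (simp add: iet_map_eq[OF T(2)] first_visit_def left_end_rauzy_veech[OF assms(1)]
        winner_def loser_def)
qed

lemma left_end_rauzy_veech_cases:
  assumes "keane_iet T"
  shows "left_end (rauzy_veech T) \<alpha> = left_end T \<alpha> \<or>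
    \<alpha> = loser T \<and> iet_map T (left_end (rauzy_veech T) \<alpha>) = left_end T \<alpha>"
  using iet_map_left_end_rauzy_veech[OF assms] left_end_rauzy_veech[OF assms, of \<alpha>] by auto

lemma top_pos_rauzy_veech_first:
  assumes "keane_iet T"
  shows "top_pos (rauzy_veech T) \<alpha> = 1 \<longleftrightarrow> top_pos T \<alpha> = 1"
proof -
  note T = keane_ietD[OF assms]
  have "top_pos T \<gamma> > 0" for \<gamma>
    using position_bounds(1)[OF is_ietD(1)[OF T(2)], of \<gamma>] by simp
  note this[of "winner T"] this[of \<alpha>]
  then show ?thesis
    by (auto simp: rauzy_veech_def move_last_after_def)
qed

lemma iet_domain_rauzy_veech_subset:
  "keane_iet T \<Longrightarrow> iet_domain (rauzy_veech T) \<subseteq> iet_domain T"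
  using is_ietD(3)[of T "loser T"] keane_ietD(2)[of T]
  by (auto simp: iet_domain_def total_length_rauzy_veech)

section \<open>Passage of the Keane property to the new map\<close>

lemma funpow_rauzy_veech:
  assumes "keane_iet T" "x \<in> iet_domain (rauzy_veech T)"
  shows "\<exists>M\<ge>m. (iet_map (rauzy_veech T) ^^ m) x = (iet_map T ^^ M) x"
proof (induction m)
  case (Suc m)
  then obtain M where M: "M \<ge> m" "(iet_map (rauzy_veech T) ^^ m) x = (iet_map T ^^ M) x"
    by blast
  note T' = is_iet_rauzy_veech[OF assms(1)]
  have "(iet_map T ^^ M) x \<in> iet_domain (rauzy_veech T)"
    using funpow_in_domain[OF T' assms(2), of m] M by simp
  then obtain \<alpha> where \<alpha>: "(iet_map T ^^ M) x \<in> subinterval (rauzy_veech T) \<alpha>"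
    using domain_cover[OF T'] by blast
  show ?case
  proof (cases "\<alpha> = loser T")
    case True
    have "(iet_map (rauzy_veech T) ^^ Suc m) x = (iet_map T ^^ Suc (Suc M)) x"
      using subinterval_rauzy_veech_loser(4)[OF assms(1)] \<alpha> True M(2) by simp
    then show ?thesis using M(1) by (intro exI[of _ "Suc (Suc M)"]) simp
  next
    case False
    have "(iet_map (rauzy_veech T) ^^ Suc m) x = (iet_map T ^^ Suc M) x"
      using subinterval_rauzy_veech_other(2)[OF assms(1)] \<alpha> False M(2) by simp
    then show ?thesis using M(1) by (intro exI[of _ "Suc M"]) simp
  qed
qed (auto intro: exI[of _ 0])

text \<open>Orbits of the new map are parts of orbits of \<open>T\<close>, and new left ends are old
  ones or their preimages, so a forbidden connection for the new map would give one for
  \<open>T\<close>.\<close>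

lemma keane_rauzy_veech:
  assumes K: "keane_iet (T :: 'a::finite iet)" shows "keane (rauzy_veech T)"
  unfolding keane_def
proof safe
  fix \<alpha> \<beta> and m :: nat assume m: "1 \<le> m" and b: "1 < top_pos (rauzy_veech T) \<beta>"
    and eq: "(iet_map (rauzy_veech T) ^^ m) (left_end (rauzy_veech T) \<alpha>) = left_end (rauzy_veech T) \<beta>"
  let ?V = "rauzy_veech T"
  note T = keane_ietD[OF K] and T' = is_iet_rauzy_veech[OF K]
  have "top_pos T \<beta> \<noteq> 1"
    using b top_pos_rauzy_veech_first[OF K, of \<beta>] by simp
  moreover have "top_pos T \<beta> \<ge> 1"
    using position_bounds[OF is_ietD(1)[OF T(2)]] by simp
  ultimately have top: "top_pos T \<beta> > 1"
    by simp
  \<comment> \<open>\<open>e\<close> is 0 or 1: a new left end equals the old one or is mapped to it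
    by \<open>T\<close>.\<close>
  obtain e where e: "(iet_map T ^^ e) (left_end ?V \<beta>) = left_end T \<beta>"
    using left_end_rauzy_veech_cases[OF K, of \<beta>] by (metis funpow_0 funpow_simps_right(2) comp_apply)
  obtain m' where m': "m = Suc m'" using m by (cases m) auto
  let ?x = "left_end ?V \<alpha>"
  have x: "?x \<in> subinterval ?V \<alpha>"
    by (rule left_end_in_subinterval[OF T'])
  \<comment> \<open>The first step is split off so that the resulting number of iterations of
    \<open>T\<close> is at least 1 in every case.\<close>
  have "iet_map ?V ?x \<in> iet_domain ?V"
    using iet_map_in_domain[OF T' left_end_in_domain[OF T']] by blast
  then obtain M where M: "(iet_map ?V ^^ m') (iet_map ?V ?x) = (iet_map T ^^ M) (iet_map ?V ?x)"
    using funpow_rauzy_veech[OF K] by blast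
  have M': "(iet_map T ^^ M) (iet_map ?V ?x) = left_end ?V \<beta>"
    using eq M by (simp add: m' funpow_swap1)
  have "\<exists>M\<ge>1. (iet_map T ^^ M) (left_end T \<alpha>) = left_end ?V \<beta>"
  proof (cases "?x = left_end T \<alpha>")
    case True
    show ?thesis
    proof (cases "\<alpha> = loser T")
      case t: True
      have "(iet_map T ^^ Suc (Suc M)) (left_end T \<alpha>) = left_end ?V \<beta>"
        using M' subinterval_rauzy_veech_loser(4)[OF K] x t unfolding True[symmetric] by (simp add: funpow_swap1)
      then show ?thesis by (intro exI[of _ "Suc (Suc M)"]) simp
    next
      case False
      have "(iet_map T ^^ Suc M) (left_end T \<alpha>) = left_end ?V \<beta>"
        using M' subinterval_rauzy_veech_other(2)[OF K x False] unfolding True[symmetric] by (simp add: funpow_swap1)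
      then show ?thesis by (intro exI[of _ "Suc M"]) simp
    qed
  next
    \<comment> \<open>The old left end is now \<open>iet_map T ?x\<close>, so of the two
      applications of \<open>T\<close> that make up the first step of the new map only the second
      remains.\<close>
    case False
    then have "\<alpha> = loser T" "iet_map T ?x = left_end T \<alpha>"
      using left_end_rauzy_veech_cases[OF K, of \<alpha>] by auto
    then have "(iet_map T ^^ Suc M) (left_end T \<alpha>) = left_end ?V \<beta>"
      using M' subinterval_rauzy_veech_loser(4)[OF K] x by (simp add: funpow_swap1)
    then show ?thesis by (intro exI[of _ "Suc M"]) simp
  qed
  then obtain M2 where "M2 \<ge> 1" "(iet_map T ^^ M2) (left_end T \<alpha>) = left_end ?V \<beta>"
    by blast
  then have "(iet_map T ^^ (e + M2)) (left_end T \<alpha>) = left_end T \<beta>" "e + M2 \<ge> 1"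
    using e by (auto simp: funpow_add)
  then show False
    using T(4) top unfolding keane_def by blast
qed

lemma keane_iet_rauzy_veech: "keane_iet T \<Longrightarrow> keane_iet (rauzy_veech T)"
  using keane_rauzy_veech admissible_rauzy_veech is_iet_rauzy_veech keane_ietD(1)
  unfolding keane_iet_def[of "rauzy_veech T"] by blast

subsection \<open>Rokhlin towers and the discontinuities of iterates\<close>

lemma rv_iter_0 [simp]: "rv_iter T 0 = T"
  and rv_iter_Suc [simp]: "rv_iter T (Suc n) = rauzy_veech (rv_iter T n)"
  by (simp_all add: rv_iter_def)

lemma keane_iet_rv_iter: "keane_iet T \<Longrightarrow> keane_iet (rv_iter T n)"
  by (induction n) (simp_all add: keane_iet_rauzy_veech)

lemma is_iet_rv_iter: "keane_iet T \<Longrightarrow> is_iet (rv_iter T n)"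
  by (simp add: keane_ietD keane_iet_rv_iter)

text \<open>The first return time of the letter's interval at time \<open>n\<close> to the domain of
  \<open>rv_iter T n\<close>, by \<open>tower_return\<close> and \<open>tower_avoids_base\<close>. A
  step stacks the towers of winner and loser to form the loser's new tower.\<close>

primrec height :: "'a::finite iet \<Rightarrow> nat \<Rightarrow> 'a \<Rightarrow> nat" where
  "height T 0 = (\<lambda>_. 1)"
| "height T (Suc n) = (height T n)(loser (rv_iter T n) :=
     height T n (winner (rv_iter T n)) + height T n (loser (rv_iter T n)))"

text \<open>\<open>delay T n \<alpha>\<close> is the level of \<open>left_end T \<alpha>\<close> in the tower over the interval of \<open>\<alpha>\<close> at time \<open>n\<close>.\<close>

primrec delay :: "'a::finite iet \<Rightarrow> nat \<Rightarrow> 'a \<Rightarrow> nat" where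
  "delay T 0 = (\<lambda>_. 0)"
| "delay T (Suc n) = (if top_type (rv_iter T n) then delay T n
     else (delay T n)(loser (rv_iter T n) :=
       height T n (winner (rv_iter T n)) + delay T n (loser (rv_iter T n))))"

lemma funpow_funpow: "(f ^^ i) ((f ^^ j) x) = (f ^^ (i + j)) x"
  by (simp add: funpow_add)

lemma height_pos: "height T n \<beta> > 0"
  by (induction n arbitrary: \<beta>) auto

lemma height_mono: "m \<le> n \<Longrightarrow> height T m \<beta> \<le> height T n \<beta>"
  by (induction n rule: dec_induct) auto

text \<open>The first visit stands on the right because \<open>funpow_add\<close> applies the right
  summand first.\<close>

lemma height_Suc_loser:
  "height T (Suc n) (loser (rv_iter T n)) =
    height T n (second_visit (rv_iter T n)) + height T n (first_visit (rv_iter T n))"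
  by (simp add: first_visit_def second_visit_def)

lemma tower_return:
  assumes "keane_iet T" "x \<in> subinterval (rv_iter T n) \<beta>"
  shows "(iet_map T ^^ height T n \<beta>) x = iet_map (rv_iter T n) x"
  using assms(2)
proof (induction n arbitrary: \<beta> x)
  case (Suc n)
  let ?S = "rv_iter T n"
  note S = keane_iet_rv_iter[OF assms(1), of n]
  have x: "x \<in> subinterval (rauzy_veech ?S) \<beta>"
    using Suc.prems by simp
  show ?case
  proof (cases "\<beta> = loser ?S")
    case True
    note * = subinterval_rauzy_veech_loser[OF S x[unfolded True]]
    show ?thesis
      unfolding True height_Suc_loser funpow_add comp_apply Suc.IH[OF *(1)] Suc.IH[OF *(2)]
      by (simp add: *(4))
  next
    case False
    then show ?thesis
      using Suc.IH subinterval_rauzy_veech_other[OF S x] by simp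
  qed
qed simp

text \<open>For the loser the orbit runs up the first tower, then meets the piece of the domain just
  cut off, then runs up the second tower; all these points miss the new domain.\<close>

lemma tower_avoids_base:
  assumes "keane_iet T" "x \<in> subinterval (rv_iter T n) \<beta>" "0 < j" "j < height T n \<beta>"
  shows "(iet_map T ^^ j) x \<notin> iet_domain (rv_iter T n)"
  using assms(2-)
proof (induction n arbitrary: \<beta> x j)
  case (Suc n)
  let ?S = "rv_iter T n"
  note S = keane_iet_rv_iter[OF assms(1), of n]
  have x: "x \<in> subinterval (rauzy_veech ?S) \<beta>"
    using Suc.prems by simp
  have sub: "iet_domain (rv_iter T (Suc n)) \<subseteq> iet_domain ?S"
    using iet_domain_rauzy_veech_subset[OF S] by simp
  show ?case
  proof (cases "\<beta> = loser ?S")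
    case True
    let ?h = "height T n (first_visit ?S)"
    note * = subinterval_rauzy_veech_loser[OF S x[unfolded True]]
    consider "j < ?h" | "j = ?h" | "j > ?h"
      by linarith
    then show ?thesis
    proof cases
      case 1
      then show ?thesis using Suc.IH[OF *(1) Suc.prems(2)] sub by blast
    next
      case 2
      then show ?thesis using *(3) by (simp add: tower_return[OF assms(1) *(1)])
    next
      case 3
      have "j - ?h < height T n (second_visit ?S)"
        using Suc.prems(3) 3 unfolding True height_Suc_loser by simp
      then have "(iet_map T ^^ (j - ?h)) (iet_map ?S x) \<notin> iet_domain ?S"
        using Suc.IH[OF *(2)] 3 by simp
      moreover have "(iet_map T ^^ j) x = (iet_map T ^^ (j - ?h + ?h)) x"
        using 3 by simp
      ultimately show ?thesis
        using sub unfolding funpow_add comp_apply tower_return[OF assms(1) *(1)] by auto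
    qed
  next
    case False
    then show ?thesis
      using Suc.IH[of x \<beta> j] subinterval_rauzy_veech_other[OF S x] Suc.prems sub by auto
  qed
qed simp

text \<open>The same stacking: the map at time \<open>n\<close> is a translation on the first
  visited interval, so differences survive the passage from the first tower to the second.\<close>

lemma tower_translation:
  assumes "keane_iet T" "x \<in> subinterval (rv_iter T n) \<beta>" "y \<in> subinterval (rv_iter T n) \<beta>"
    "j < height T n \<beta>"
  shows "(iet_map T ^^ j) x - (iet_map T ^^ j) y = x - y"
  using assms(2-)
proof (induction n arbitrary: \<beta> x y j)
  case (Suc n)
  let ?S = "rv_iter T n"
  note S = keane_iet_rv_iter[OF assms(1), of n]
  have x: "x \<in> subinterval (rauzy_veech ?S) \<beta>" and y: "y \<in> subinterval (rauzy_veech ?S) \<beta>"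
    using Suc.prems by simp_all
  show ?case
  proof (cases "\<beta> = loser ?S")
    case True
    let ?h = "height T n (first_visit ?S)"
    note xs = subinterval_rauzy_veech_loser[OF S x[unfolded True]]
    note ys = subinterval_rauzy_veech_loser[OF S y[unfolded True]]
    show ?thesis
    proof (cases "j < ?h")
      case True
      then show ?thesis using Suc.IH[OF xs(1) ys(1)] by blast
    next
      case False
      have "j - ?h < height T n (second_visit ?S)"
        using Suc.prems(3) False unfolding True height_Suc_loser by simp
      note IH = Suc.IH[OF xs(2) ys(2) this]
      have "j = j - ?h + ?h"
        using False by simp
      then have j: "(iet_map T ^^ j) z = (iet_map T ^^ (j - ?h)) ((iet_map T ^^ ?h) z)" for z
        by (metis funpow_add comp_apply)
      show ?thesis
        using IH iet_map_eq[OF is_iet_rv_iter[OF assms(1)] xs(1)]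
          iet_map_eq[OF is_iet_rv_iter[OF assms(1)] ys(1)]
        unfolding j tower_return[OF assms(1) xs(1)] tower_return[OF assms(1) ys(1)] by simp
    qed
  next
    case False
    then show ?thesis
      using Suc.IH[of x \<beta> y j] subinterval_rauzy_veech_other[OF S x]
        subinterval_rauzy_veech_other[OF S y] Suc.prems by auto
  qed
qed simp

lemma delay_less_height: "delay T n \<alpha> < height T n \<alpha>"
  by (induction n arbitrary: \<alpha>) (auto simp: trans_less_add2 less_imp_le_nat)

lemma delay_left_end:
  assumes "keane_iet T"
  shows "(iet_map T ^^ delay T n \<alpha>) (left_end (rv_iter T n) \<alpha>) = left_end T \<alpha>"
proof (induction n)
  case (Suc n)
  let ?S = "rv_iter T n"
  note S = keane_iet_rv_iter[OF assms, of n]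
  show ?case
  proof (cases "\<not> top_type ?S \<and> \<alpha> = loser ?S")
    case True
    let ?e = "left_end (rauzy_veech ?S) (loser ?S)"
    have "?e \<in> subinterval (rauzy_veech ?S) (loser ?S)"
      by (intro left_end_in_subinterval is_iet_rauzy_veech S)
    then have "?e \<in> subinterval ?S (winner ?S)"
      using subinterval_rauzy_veech_loser(1)[OF S] True by (force simp: first_visit_def)
    \<comment> \<open>One step of \<open>?S\<close> leads from the new left end to the old one and
      costs the winner's height in steps of \<open>T\<close>; this is the increment in
      \<open>delay\<close>.\<close>
    then have "(iet_map T ^^ height T n (winner ?S)) ?e = left_end ?S \<alpha>"
      using tower_return[OF assms] iet_map_left_end_rauzy_veech[OF S] True by metis
    moreover have "delay T (Suc n) \<alpha> = delay T n \<alpha> + height T n (winner ?S)"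
      using True by simp
    ultimately show ?thesis
      using Suc.IH True by (simp add: funpow_add del: delay.simps)
  next
    case False
    have "left_end (rauzy_veech ?S) \<alpha> = left_end ?S \<alpha>"
      unfolding left_end_rauzy_veech[OF S] using False by auto
    then show ?thesis
      using Suc.IH False by auto
  qed
qed simp

text \<open>A left end moves only when its letter loses a bottom step. The delay then exceeds the
  winner's current height, which is at least its height at time \<open>m\<close>.\<close>

lemma left_end_stable_or_delay_ge:
  assumes "keane_iet T" "m \<le> n"
  shows "left_end (rv_iter T n) \<alpha> = left_end (rv_iter T m) \<alpha> \<or> (\<exists>\<gamma>. height T m \<gamma> \<le> delay T n \<alpha>)"
  using assms(2)
proof (induction n rule: dec_induct)
  case (step n)
  let ?S = "rv_iter T n"
  note S = keane_iet_rv_iter[OF assms(1), of n]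
  show ?case
  proof (cases "\<not> top_type ?S \<and> \<alpha> = loser ?S")
    case True
    have "height T m (winner ?S) \<le> height T n (winner ?S)"
      using step.hyps by (intro height_mono) simp
    then have "height T m (winner ?S) \<le> delay T (Suc n) \<alpha>"
      using True by simp
    then show ?thesis by blast
  next
    case False
    have "left_end (rauzy_veech ?S) \<alpha> = left_end ?S \<alpha>"
      unfolding left_end_rauzy_veech[OF S] using False by auto
    then show ?thesis
      using step.IH False by auto
  qed
qed simp

section \<open>The left ends of the tower levels and the gaps between them\<close>

definition levels :: "'a::finite iet \<Rightarrow> nat \<Rightarrow> real set" where
  "levels T n = {(iet_map T ^^ j) (left_end (rv_iter T n) \<beta>) | \<beta> j. j < height T n \<beta>}"

lemma finite_levels: "finite (levels T n)"
proof -
  have "levels T n = (\<Union>\<beta>. (\<lambda>j. (iet_map T ^^ j) (left_end (rv_iter T n) \<beta>)) ` {..<height T n \<beta>})"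
    by (auto simp: levels_def)
  then show ?thesis by simp
qed

lemma iet_domain_rv_iter_subset: "keane_iet T \<Longrightarrow> iet_domain (rv_iter T n) \<subseteq> iet_domain T"
  by (induction n) (use iet_domain_rauzy_veech_subset keane_iet_rv_iter in fastforce)+

lemma subinterval_rv_iter_subset: "keane_iet T \<Longrightarrow> subinterval (rv_iter T n) \<beta> \<subseteq> iet_domain T"
  using subinterval_subset_domain[OF is_iet_rv_iter] iet_domain_rv_iter_subset by blast

lemma levels_subset: "keane_iet T \<Longrightarrow> levels T n \<subseteq> iet_domain T"
  using subsetD[OF subinterval_rv_iter_subset left_end_in_subinterval[OF is_iet_rv_iter]]
    funpow_in_domain[of T]
  by (force simp: levels_def keane_ietD)

text \<open>Levels are disjoint: a common point of two levels, pulled back by injectivity, would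
  yield a base point whose orbit meets the base before its return time. So no left end lies inside
  another level.\<close>

lemma levels_gap_less:
  assumes K: "keane_iet T" and "a \<in> levels T n" "b \<in> levels T n" "a < b"
  shows "\<exists>\<gamma>. len (rv_iter T n) \<gamma> \<le> b - a"
proof -
  let ?S = "rv_iter T n"
  note T = keane_ietD(2)[OF K] and S = is_iet_rv_iter[OF K, of n]
  note sub = subinterval_rv_iter_subset[OF K, of n]
  obtain \<alpha> i \<beta> j where a: "a = (iet_map T ^^ i) (left_end ?S \<alpha>)" "i < height T n \<alpha>"
    and b: "b = (iet_map T ^^ j) (left_end ?S \<beta>)" "j < height T n \<beta>"
    using assms(2,3) unfolding levels_def by blast
  have "len ?S \<alpha> \<le> b - a"
  proof (rule ccontr)
    assume less: "\<not> len ?S \<alpha> \<le> b - a"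
    \<comment> \<open>\<open>x\<close> is the base point below \<open>b\<close>, supposing that
      \<open>b\<close> lies in the level starting at \<open>a\<close>.\<close>
    define x where "x = left_end ?S \<alpha> + (b - a)"
    have x: "x \<in> subinterval ?S \<alpha>"
      using less assms(4) by (simp add: x_def subinterval_def)
    note l\<alpha> = left_end_in_subinterval[OF S, of \<alpha>] and l\<beta> = left_end_in_subinterval[OF S, of \<beta>]
    have eq: "(iet_map T ^^ i) x = (iet_map T ^^ j) (left_end ?S \<beta>)"
      using tower_translation[OF K x l\<alpha> a(2)] a b by (simp add: x_def)
    have xd: "x \<in> iet_domain T" and bd: "left_end ?S \<beta> \<in> iet_domain T"
      using sub x l\<beta> by auto
    have neq: "x \<noteq> left_end ?S \<beta> \<or> i \<noteq> j"
    proof (rule ccontr)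
      assume "\<not> ?thesis"
      then have "x = left_end ?S \<beta>" "\<alpha> = \<beta>"
        using subinterval_unique[OF S x] l\<beta> by auto
      then show False using assms(4) by (simp add: x_def)
    qed
    consider "i = j" | "i < j" | "j < i"
      by linarith
    then show False
    proof cases
      case 1
      then show False using funpow_inj[OF T xd bd] eq neq by simp
    next
      case 2
      then have "(iet_map T ^^ i) x = (iet_map T ^^ i) ((iet_map T ^^ (j - i)) (left_end ?S \<beta>))"
        using eq by (simp add: funpow_funpow)
      then have "x = (iet_map T ^^ (j - i)) (left_end ?S \<beta>)"
        using funpow_inj[OF T xd funpow_in_domain[OF T bd]] by blast
      then show False
        using tower_avoids_base[OF K l\<beta>, of "j - i"] 2 less_imp_diff_less[OF b(2), of i] subinterval_subset_domain[OF S, of \<alpha>] x by auto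
    next
      case 3
      then have "(iet_map T ^^ j) ((iet_map T ^^ (i - j)) x) = (iet_map T ^^ j) (left_end ?S \<beta>)"
        using eq by (simp add: funpow_funpow)
      then have "(iet_map T ^^ (i - j)) x = left_end ?S \<beta>"
        using funpow_inj[OF T funpow_in_domain[OF T xd] bd] by blast
      then show False
        using tower_avoids_base[OF K x, of "i - j"] 3 less_imp_diff_less[OF a(2), of j] left_end_in_domain[OF S, of \<beta>] by auto
    qed
  qed
  then show ?thesis by blast
qed

text \<open>The whole level starting at \<open>a\<close> is a translate of its base interval inside
  the domain.\<close>

lemma levels_gap_end:
  assumes K: "keane_iet T" and "a \<in> levels T n"
  shows "\<exists>\<gamma>. len (rv_iter T n) \<gamma> \<le> total_length T - a"
proof -
  let ?S = "rv_iter T n"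
  note T = keane_ietD(2)[OF K] and S = is_iet_rv_iter[OF K, of n]
  obtain \<alpha> i where a: "a = (iet_map T ^^ i) (left_end ?S \<alpha>)" "i < height T n \<alpha>"
    using assms(2) unfolding levels_def by blast
  have "a + t < total_length T" if "0 \<le> t" "t < len ?S \<alpha>" for t
  proof -
    have x: "left_end ?S \<alpha> + t \<in> subinterval ?S \<alpha>"
      using that by (simp add: subinterval_def)
    have "(iet_map T ^^ i) (left_end ?S \<alpha> + t) = a + t"
      using tower_translation[OF K x left_end_in_subinterval[OF S] a(2)] a(1) by simp
    moreover have "(iet_map T ^^ i) (left_end ?S \<alpha> + t) \<in> iet_domain T"
      using funpow_in_domain[OF T] subinterval_rv_iter_subset[OF K] x by blast
    ultimately show ?thesis by (simp add: iet_domain_def)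
  qed
  from this[of "total_length T - a"] this[of 0] have "len ?S \<alpha> \<le> total_length T - a"
    using is_ietD(3)[OF S, of \<alpha>] by force
  then show ?thesis by blast
qed

text \<open>Descending at most \<open>delay T n \<alpha>\<close> levels from
  \<open>left_end T \<alpha>\<close> stays in the tower over \<alpha> and ends at the left end of a
  level; injectivity makes this the only preimage.\<close>

lemma discont_iter_subset_levels:
  assumes K: "keane_iet T" and "\<And>\<alpha>. top_pos T \<alpha> > 1 \<Longrightarrow> m \<le> Suc (delay T n \<alpha>)"
  shows "discont_iter T m \<subseteq> levels T n"
proof
  note T = keane_ietD(2)[OF K]
  fix x assume "x \<in> discont_iter T m"
  then obtain i \<alpha> where x: "i < m" "x \<in> iet_domain T" "(iet_map T ^^ i) x = left_end T \<alpha>"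
    "top_pos T \<alpha> > 1"
    by (auto simp: discont_iter_def discont_def)
  let ?l = "left_end (rv_iter T n) \<alpha>" and ?h = "delay T n \<alpha>"
  have le: "i \<le> ?h"
    using assms(2)[OF x(4)] x(1) by simp
  have ld: "?l \<in> iet_domain T"
    using left_end_in_subinterval[OF is_iet_rv_iter[OF K]] subinterval_rv_iter_subset[OF K] by blast
  have "(iet_map T ^^ i) x = (iet_map T ^^ i) ((iet_map T ^^ (?h - i)) ?l)"
    using delay_left_end[OF K, of n \<alpha>] x(3) le
    by (simp add: funpow_funpow)
  then have "x = (iet_map T ^^ (?h - i)) ?l"
    using funpow_inj[OF T x(2) funpow_in_domain[OF T ld]] by blast
  moreover have "?h - i < height T n \<alpha>"
    using delay_less_height[of T n \<alpha>] by simp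
  ultimately show "x \<in> levels T n"
    unfolding levels_def by blast
qed

lemma zero_in_levels:
  assumes "keane_iet (T :: 'a::finite iet)" shows "0 \<in> levels T n"
proof -
  note S = is_iet_rv_iter[OF assms, of n]
  have "1 \<in> range (top_pos (rv_iter T n))"
    using is_ietD(1)[OF S] by (simp add: bij_betw_def Suc_leI)
  then obtain \<alpha> where "top_pos (rv_iter T n) \<alpha> = 1"
    by (metis imageE)
  then have "left_end (rv_iter T n) \<alpha> = 0"
    using offset_first[OF is_ietD(1)[OF S]] by (simp add: left_end_offset)
  then have "0 = (iet_map T ^^ 0) (left_end (rv_iter T n) \<alpha>)"
    by simp
  then show ?thesis
    using height_pos[of T n \<alpha>] unfolding levels_def by blast
qed

text \<open>The point 0 is the left end of a level, but 1 is the right end of the domain and is not.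
  Gaps below 1 come from \<open>levels_gap_less\<close>, those ending at 1 from
  \<open>levels_gap_end\<close>.\<close>

lemma min_gap_ge:
  assumes K: "keane_iet T" and "total_length T = 1"
    and "\<And>\<alpha>. top_pos T \<alpha> > 1 \<Longrightarrow> m \<le> Suc (delay T n \<alpha>)"
    and c: "\<And>\<gamma>. c \<le> len (rv_iter T n) \<gamma>"
  shows "c \<le> min_gap T m"
proof -
  let ?D = "discont_iter T m \<union> {0, 1}"
  let ?G = "{dist x y | x y. x \<in> ?D \<and> y \<in> ?D \<and> x \<noteq> y}"
  have D: "?D \<subseteq> insert 1 (levels T n)"
    using discont_iter_subset_levels[OF K assms(3)] zero_in_levels[OF K] by auto
  then have fin: "finite ?D"
    using finite_levels finite_subset by blast
  have "?G \<subseteq> (\<lambda>(x, y). dist x y) ` (?D \<times> ?D)"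
    by auto
  then have "finite ?G"
    using fin finite_subset by blast
  moreover have "?G \<noteq> {}"
  proof -
    have "dist 0 (1::real) \<in> ?G" by force
    then show ?thesis by blast
  qed
  moreover have less: "c \<le> y - x" if "x \<in> ?D" "y \<in> ?D" "x < y" for x y
  proof (cases "y \<in> levels T n")
    case True
    then have "y < 1"
      using levels_subset[OF K] assms(2) by (force simp: iet_domain_def)
    then have "x \<in> levels T n"
      using D that by auto
    then show ?thesis
      using levels_gap_less[OF K _ True that(3)] c order_trans by blast
  next
    case False
    then have "y = 1" "x \<in> levels T n"
      using D that by auto
    then show ?thesis
      using levels_gap_end[OF K, of x n] assms(2) c order_trans by metis
  qed
  have "c \<le> dist x y" if "x \<in> ?D" "y \<in> ?D" "x \<noteq> y" for x y
    using less[OF that(1,2)] less[OF that(2,1)] that(3)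
    by (cases "x < y") (auto simp: dist_real_def)
  then have "\<forall>g\<in>?G. c \<le> g"
    by blast
  ultimately show ?thesis
    unfolding min_gap_def by (subst Min_ge_iff) blast+
qed

subsection \<open>The matrices of the algorithm\<close>

text \<open>Left multiplication adds the winner's row to the loser's row, just as the step adds the
  winner's height to the loser's.\<close>

lemma step_matrix_mult:
  "(step_matrix S ** M) $ i $ j = M $ i $ j + (if i = loser S then M $ winner S $ j else 0)"
proof -
  have "(step_matrix S ** M) $ i $ j =
    (\<Sum>k\<in>UNIV. (if i = k then M $ k $ j else 0) +
      (if k = winner S then (if i = loser S then M $ k $ j else 0) else 0))"
    unfolding matrix_matrix_mult_def step_matrix_def by (auto simp: mat_def algebra_simps intro!: sum.cong)
  also have "\<dots> = M $ i $ j + (if i = loser S then M $ winner S $ j else 0)"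
    by (simp add: sum.distrib)
  finally show ?thesis .
qed

lemma Q_mat_refl [simp]: "Q_mat T m m = mat 1"
  by (cases m) auto

lemma Q_mat_Suc_entry:
  "m \<le> n \<Longrightarrow> Q_mat T m (Suc n) $ i $ j = Q_mat T m n $ i $ j +
    (if i = loser (rv_iter T n) then Q_mat T m n $ winner (rv_iter T n) $ j else 0)"
  by (simp add: step_matrix_mult)

lemma Q_mat_nonneg: "m \<le> n \<Longrightarrow> Q_mat T m n $ i $ j \<ge> 0"
proof (induction n arbitrary: i rule: dec_induct)
  case (step n)
  then show ?case by (simp add: Q_mat_Suc_entry del: Q_mat.simps)
qed (simp add: mat_def)

lemma Q_mat_height:
  assumes "m \<le> n"
  shows "real (height T n \<beta>) = (\<Sum>\<gamma>\<in>UNIV. Q_mat T m n $ \<beta> $ \<gamma> * height T m \<gamma>)"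
  using assms
proof (induction n arbitrary: \<beta> rule: dec_induct)
  case base
  then show ?case by (simp add: mat_def if_distrib[of "\<lambda>x. x * _"] cong: if_cong)
next
  case (step n)
  then show ?case
    by (simp add: Q_mat_Suc_entry sum.distrib algebra_simps del: Q_mat.simps)
qed

text \<open>Heights are carried forward by \<open>Q_mat\<close>, lengths backward by its
  transpose.\<close>

lemma Q_mat_len:
  assumes K: "keane_iet T" and "m \<le> n"
  shows "len (rv_iter T m) \<gamma> = (\<Sum>\<beta>\<in>UNIV. len (rv_iter T n) \<beta> * Q_mat T m n $ \<beta> $ \<gamma>)"
  using assms(2)
proof (induction n rule: dec_induct)
  case base
  then show ?case by (simp add: mat_def if_distrib[of "\<lambda>x. _ * x"] cong: if_cong)
next
  case (step n)
  let ?S = "rv_iter T n" and ?Q = "\<lambda>\<beta>. Q_mat T m n $ \<beta> $ \<gamma>"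
  \<comment> \<open>The two correction terms cancel: the loss in the winner's length is made up by
    the winner's row added to the loser's.\<close>
  have "(\<Sum>\<beta>\<in>UNIV. len (rv_iter T (Suc n)) \<beta> * Q_mat T m (Suc n) $ \<beta> $ \<gamma>) =
    (\<Sum>\<beta>\<in>UNIV. len ?S \<beta> * ?Q \<beta>
      + (if \<beta> = winner ?S then - len ?S (loser ?S) * ?Q \<beta> else 0)
      + (if \<beta> = loser ?S then len ?S \<beta> * ?Q (winner ?S) else 0))"
    using step.hyps winner_neq_loser[OF keane_iet_rv_iter[OF K]]
    by (intro sum.cong) (auto simp: Q_mat_Suc_entry len_rauzy_veech algebra_simps simp del: Q_mat.simps)
  also have "\<dots> = (\<Sum>\<beta>\<in>UNIV. len ?S \<beta> * ?Q \<beta>)"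
    by (simp add: sum.distrib)
  finally show ?case using step.IH by simp
qed

text \<open>This is the norm of \<open>Q_mat T 0 n\<close>, since all heights at time 0 are 1 and
  the entries are nonnegative.\<close>

definition total_height :: "'a::finite iet \<Rightarrow> nat \<Rightarrow> real" where
  "total_height T n = (\<Sum>\<beta>\<in>UNIV. real (height T n \<beta>))"

lemma matrix_norm1_Q_mat_0: "matrix_norm1 (Q_mat T 0 n) = total_height T n"
  unfolding matrix_norm1_def total_height_def
  by (intro sum.cong refl) (simp add: Q_mat_height[of 0] Q_mat_nonneg)

lemma height_le_total_height: "real (height T n \<beta>) \<le> total_height T n"
  unfolding total_height_def by (intro member_le_sum) auto

lemma total_height_le_mult:
  assumes "m \<le> n"
  shows "total_height T n \<le> matrix_norm1 (Q_mat T m n) * total_height T m"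
proof -
  have "total_height T n = (\<Sum>\<beta>\<in>UNIV. \<Sum>\<gamma>\<in>UNIV. Q_mat T m n $ \<beta> $ \<gamma> * height T m \<gamma>)"
    unfolding total_height_def by (intro sum.cong refl Q_mat_height assms)
  also have "\<dots> \<le> (\<Sum>\<beta>\<in>UNIV. \<Sum>\<gamma>\<in>UNIV. \<bar>Q_mat T m n $ \<beta> $ \<gamma>\<bar> * total_height T m)"
    by (intro sum_mono mult_mono height_le_total_height) auto
  finally show ?thesis
    by (simp add: matrix_norm1_def sum_distrib_right)
qed

text \<open>Each step raises the loser's height by at least 1. In particular total heights exceed
  every given number.\<close>

lemma total_height_ge: "real n + 1 \<le> total_height T n"
proof (induction n)
  case 0
  have "real (height T 0 undefined) \<le> total_height T 0"
    by (rule height_le_total_height)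
  then show ?case by simp
next
  case (Suc n)
  let ?l = "loser (rv_iter T n)"
  have split: "sum f UNIV = f ?l + sum f (UNIV - {?l})" for f :: "'a \<Rightarrow> real"
    by (simp add: sum.remove)
  have "sum (\<lambda>\<beta>. real (height T (Suc n) \<beta>)) (UNIV - {?l}) = sum (\<lambda>\<beta>. real (height T n \<beta>)) (UNIV - {?l})"
    by (intro sum.cong) auto
  moreover have "real (height T (Suc n) ?l) \<ge> real (height T n ?l) + 1"
    using height_pos[of T n "winner (rv_iter T n)"] by simp
  ultimately have "total_height T n + 1 \<le> total_height T (Suc n)"
    unfolding total_height_def split by linarith
  then show ?case using Suc.IH by simp
qed

lemma total_height_mono: "m \<le> n \<Longrightarrow> total_height T m \<le> total_height T n"
  unfolding total_height_def by (intro sum_mono) (simp add: height_mono)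

lemma height_ge_total_height:
  assumes "m \<le> n" "\<And>\<gamma>. Q_mat T m n $ \<beta> $ \<gamma> \<ge> 1"
  shows "total_height T m \<le> height T n \<beta>"
  unfolding Q_mat_height[OF assms(1)] total_height_def
proof (rule sum_mono)
  show "real (height T m \<gamma>) \<le> Q_mat T m n $ \<beta> $ \<gamma> * real (height T m \<gamma>)" for \<gamma>
    using mult_right_mono[OF assms(2)[of \<gamma>], of "real (height T m \<gamma>)"] by simp
qed

lemma len_ge_total_length:
  assumes "keane_iet T" "m \<le> n" "\<And>\<beta>. Q_mat T m n $ \<beta> $ \<gamma> \<ge> 1"
  shows "total_length (rv_iter T n) \<le> len (rv_iter T m) \<gamma>"
  unfolding Q_mat_len[OF assms(1,2), of \<gamma>] total_length_def
proof (rule sum_mono)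
  show "len (rv_iter T n) \<beta> \<le> len (rv_iter T n) \<beta> * Q_mat T m n $ \<beta> $ \<gamma>" for \<beta>
    using mult_left_mono[OF assms(3)[of \<beta>], of "len (rv_iter T n) \<beta>"]
      is_ietD(3)[OF is_iet_rv_iter[OF assms(1)], of n \<beta>] by simp
qed

text \<open>The towers fill the domain: its length is the sum of length times height over all
  letters.\<close>

lemma total_length_le_mult:
  assumes "keane_iet T"
  shows "total_length T \<le> total_length (rv_iter T n) * total_height T n"
proof -
  note S = is_iet_rv_iter[OF assms, of n]
  have "total_length T = (\<Sum>\<gamma>\<in>UNIV. \<Sum>\<beta>\<in>UNIV. len (rv_iter T n) \<beta> * Q_mat T 0 n $ \<beta> $ \<gamma>)"
    using Q_mat_len[OF assms, of 0 n] by (simp add: total_length_def)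
  also have "\<dots> = (\<Sum>\<beta>\<in>UNIV. len (rv_iter T n) \<beta> * height T n \<beta>)"
    by (subst sum.swap) (simp add: Q_mat_height[of 0] sum_distrib_left)
  also have "\<dots> \<le> (\<Sum>\<beta>\<in>UNIV. total_length (rv_iter T n) * height T n \<beta>)"
    unfolding total_length_def
    by (intro sum_mono mult_right_mono member_le_sum) (auto simp: less_imp_le is_ietD(3)[OF S])
  finally show ?thesis
    by (simp add: total_height_def sum_distrib_left)
qed

subsection \<open>Every letter wins infinitely often\<close>

text \<open>Each step shortens the domain by the loser's length, while the total length stays
  positive.\<close>

lemma finite_large_losses:
  assumes K: "keane_iet T" and "\<delta> > 0"
  shows "finite {n. \<delta> \<le> len (rv_iter T n) (loser (rv_iter T n))}" (is "finite ?A")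
proof (rule ccontr)
  assume inf: "infinite ?A"
  have bound: "total_length (rv_iter T n) + \<delta> * card (?A \<inter> {..<n}) \<le> total_length T" for n
  proof (induction n)
    case (Suc n)
    let ?l = "len (rv_iter T n) (loser (rv_iter T n))"
    have "\<delta> * card (?A \<inter> {..<Suc n}) \<le> \<delta> * card (?A \<inter> {..<n}) + ?l"
    proof (cases "n \<in> ?A")
      case True
      then have "?A \<inter> {..<Suc n} = insert n (?A \<inter> {..<n})"
        by auto
      then show ?thesis using True by (simp add: algebra_simps)
    next
      case False
      then have "?A \<inter> {..<Suc n} = ?A \<inter> {..<n}"
        by (auto simp: less_Suc_eq)
      then show ?thesis
        using is_ietD(3)[OF is_iet_rv_iter[OF K, of n], of "loser (rv_iter T n)"] by simp
    qed
    then show ?case using Suc.IH by (simp add: total_length_rauzy_veech)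
  qed simp
  obtain N where N: "total_length T < \<delta> * real N"
    using ex_less_of_nat_mult[OF assms(2), of "total_length T"] by (auto simp: mult.commute)
  obtain B where B: "finite B" "card B = N" "B \<subseteq> ?A"
    using infinite_arbitrarily_large[OF inf] by blast
  obtain n where "B \<subseteq> {..<n}"
    using finite_nat_bounded[OF B(1)] by blast
  then have "N \<le> card (?A \<inter> {..<n})"
    using B by (metis card_mono finite_Int finite_lessThan le_inf_iff)
  then have "\<delta> * N \<le> \<delta> * card (?A \<inter> {..<n})"
    using assms(2) by simp
  then show False
    using N bound[of n] total_length_pos[OF is_iet_rv_iter[OF K, of n]] by linarith
qed

text \<open>Brings a set of leading letters into the form used in \<open>admissible\<close>. All
  letters up to some \<open>u\<close> in \<open>U\<close> lie in \<open>U\<close>, so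
  \<open>p u\<close> is at most \<open>card U\<close>; counting gives equality.\<close>

lemma initial_segment_vimage:
  assumes p: "bij_betw p UNIV {1..CARD('a::finite)}" and U: "\<And>u \<alpha>. u \<in> U \<Longrightarrow> \<alpha> \<notin> U \<Longrightarrow> p u < p (\<alpha>::'a)"
  shows "p -` {1..card U} = U"
proof -
  have card: "card (p -` {1..k}) = k" if "k \<le> CARD('a)" for k
    using p that by (subst card_vimage_inj) (auto simp: bij_betw_def)
  have "u \<in> p -` {1..card U}" if "u \<in> U" for u
  proof -
    have "p -` {1..p u} \<subseteq> U"
      using U[OF that] by (force simp: not_less)
    then have "card (p -` {1..p u}) \<le> card U"
      by (intro card_mono) auto
    then show ?thesis
      using card[of "p u"] position_bounds[OF p, of u] by simp
  qed
  then have "U \<subseteq> p -` {1..card U}"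
    by blast
  then show ?thesis
    using card[of "card U"] card_mono[of UNIV U] card_subset_eq[of "p -` {1..card U}" U] by simp
qed

lemma move_last_after_ge: "\<gamma> \<noteq> lo \<Longrightarrow> p \<gamma> \<le> move_last_after p lo w \<gamma>"
  by (simp add: move_last_after_def)

lemma top_pos_rauzy_veech:
  "top_pos (rauzy_veech T) = (if top_type T then top_pos T
     else move_last_after (top_pos T) (loser T) (winner T))"
  by (simp add: rauzy_veech_def)

lemma bot_pos_rauzy_veech:
  "bot_pos (rauzy_veech T) = (if top_type T
     then move_last_after (bot_pos T) (loser T) (winner T) else bot_pos T)"
  by (simp add: rauzy_veech_def)

text \<open>
  Letters that win only finitely often eventually have constant lengths, hence also lose only
  finitely often. From then on their positions can only grow; once these are stable, such letters
  precede every later winner in both orders, so they form a common initial segment of the two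
  orders, which admissibility forbids.
\<close>

lemma winner_infinitely_often:
  assumes K: "keane_iet (T :: 'a::finite iet)"
  shows "\<exists>n\<ge>m. winner (rv_iter T n) = \<alpha>"
proof -
  let ?w = "\<lambda>n. winner (rv_iter T n)" and ?l = "\<lambda>n. loser (rv_iter T n)"
  define U where "U = {\<alpha>. \<not> (\<forall>m. \<exists>n\<ge>m. ?w n = \<alpha>)}"
  have "U = {}"
  proof (rule ccontr)
    assume U: "U \<noteq> {}"
    have "\<forall>\<alpha>\<in>U. \<forall>\<^sub>F n in sequentially. ?w n \<noteq> \<alpha>"
      unfolding U_def eventually_sequentially by blast
    then have "\<forall>\<^sub>F n in sequentially. \<forall>\<alpha>\<in>U. ?w n \<noteq> \<alpha>"
      by (intro eventually_ball_finite) auto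
    then obtain n0 where n0: "\<And>n. n \<ge> n0 \<Longrightarrow> ?w n \<notin> U"
      unfolding eventually_sequentially by blast
    have const: "len (rv_iter T n) u = len (rv_iter T n0) u" if "n \<ge> n0" "u \<in> U" for n u
      using that(1)
    proof (induction n rule: dec_induct)
      case (step n)
      then show ?case using n0[of n] that(2) by (auto simp: len_rauzy_veech)
    qed simp
    define \<delta> where "\<delta> = Min (len (rv_iter T n0) ` U)"
    have "\<delta> > 0"
      unfolding \<delta>_def using U is_ietD(3)[OF is_iet_rv_iter[OF K]] by simp
    then have "\<forall>\<^sub>F n in sequentially. \<not> \<delta> \<le> len (rv_iter T n) (?l n)"
      using finite_large_losses[OF K] by (simp add: eventually_cofinite flip: cofinite_eq_sequentially)
    then obtain n1 where n1: "\<And>n. n \<ge> n1 \<Longrightarrow> len (rv_iter T n) (?l n) < \<delta>"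
      unfolding eventually_sequentially by (auto simp: not_le)
    have lU: "?l n \<notin> U" if "n \<ge> max n0 n1" for n
    proof
      assume "?l n \<in> U"
      then have "\<delta> \<le> len (rv_iter T n0) (?l n)"
        unfolding \<delta>_def by (intro Min_le) auto
      then show False
        using n1[of n] const[of n] \<open>?l n \<in> U\<close> that by simp
    qed
    have topmono: "top_pos (rv_iter T n) u \<le> top_pos (rv_iter T (Suc n)) u"
      and botmono: "bot_pos (rv_iter T n) u \<le> bot_pos (rv_iter T (Suc n)) u"
      if "n \<ge> max n0 n1" "u \<in> U" for n u
      using lU[OF that(1)] that(2)
      by (auto simp: top_pos_rauzy_veech bot_pos_rauzy_veech intro: move_last_after_ge)
    \<comment> \<open>One bounded quantity recording all positions of letters of \<open>U\<close>.
      It is nondecreasing, hence constant from the time \<open>n2\<close> of its maximum on.\<close>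
    define f where "f n = (\<Sum>u\<in>U. top_pos (rv_iter T n) u + bot_pos (rv_iter T n) u)" for n
    have fmono: "f n \<le> f (Suc n)" if "n \<ge> max n0 n1" for n
      unfolding f_def using topmono[OF that] botmono[OF that] by (intro sum_mono add_mono) auto
    have fbound: "f n < Suc (card U * (CARD('a) + CARD('a)))" for n
    proof -
      have "f n \<le> card U * (CARD('a) + CARD('a))"
        unfolding f_def using is_ietD(1,2)[OF is_iet_rv_iter[OF K, of n]]
        by (intro sum_bounded_above[of U _ "CARD('a) + CARD('a)", simplified] add_mono position_bounds)
      then show ?thesis by simp
    qed
    obtain n2 where n2: "n2 \<ge> max n0 n1" "\<And>n. n \<ge> max n0 n1 \<Longrightarrow> f n \<le> f n2"
      using ex_has_greatest_nat[of "\<lambda>n. n \<ge> max n0 n1" "max n0 n1" f] fbound by (metis order_refl)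
    have ffix: "f n = f n2" if "n \<ge> n2" for n
      using that
    proof (induction n rule: dec_induct)
      case (step n)
      then show ?case using fmono[of n] n2(2)[of "Suc n"] n2(1) by simp
    qed simp
    have fixpos: "top_pos (rv_iter T (Suc n)) u = top_pos (rv_iter T n) u"
      "bot_pos (rv_iter T (Suc n)) u = bot_pos (rv_iter T n) u" if "n \<ge> n2" "u \<in> U" for n u
    proof -
      have n: "n \<ge> max n0 n1"
        using that n2 by simp
      let ?g = "\<lambda>n u. top_pos (rv_iter T n) u + bot_pos (rv_iter T n) u"
      have sum: "sum (?g n) U = sum (?g (Suc n)) U"
        using ffix[of n] ffix[of "Suc n"] that(1) unfolding f_def by (simp del: rv_iter_Suc)
      \<comment> \<open>Equal sums of termwise comparable families have equal terms.\<close>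
      have "?g n u = ?g (Suc n) u"
        by (rule sum_mono_inv[OF sum _ that(2)]) (use topmono[OF n] botmono[OF n] add_mono in blast, simp)
      then show "top_pos (rv_iter T (Suc n)) u = top_pos (rv_iter T n) u"
        "bot_pos (rv_iter T (Suc n)) u = bot_pos (rv_iter T n) u"
        using topmono[OF n that(2)] botmono[OF n that(2)] by simp_all
    qed
    \<comment> \<open>In the kept order the winner is last. In the other order a letter behind the
      winner, other than the loser, would be shifted, contrary to \<open>fixpos\<close>.\<close>
    have dom: "top_pos (rv_iter T n) u < top_pos (rv_iter T n) (?w n)"
      "bot_pos (rv_iter T n) u < bot_pos (rv_iter T n) (?w n)" if "n \<ge> n2" "u \<in> U" for n u
    proof -
      let ?S = "rv_iter T n"
      note S = is_iet_rv_iter[OF K, of n]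
      have "u \<noteq> ?w n" "u \<noteq> ?l n"
        using n0[of n] lU[of n] n2(1) that by auto
      moreover have "top_pos ?S u \<le> top_pos ?S (?w n)"
      proof (cases "top_type ?S")
        case True
        then show ?thesis
          using position_bounds(2)[OF is_ietD(1)[OF S], of u] top_pos_last_top[OF S] by (simp add: winner_def)
      next
        case False
        then show ?thesis
          using fixpos(1)[OF that] \<open>u \<noteq> ?l n\<close>
          by (auto simp: top_pos_rauzy_veech move_last_after_def split: if_splits)
      qed
      moreover have "bot_pos ?S u \<le> bot_pos ?S (?w n)"
      proof (cases "top_type ?S")
        case False
        then show ?thesis
          using position_bounds(2)[OF is_ietD(2)[OF S], of u] bot_pos_last_bot[OF S] by (simp add: winner_def)
      next
        case True
        then show ?thesis
          using fixpos(2)[OF that] \<open>u \<noteq> ?l n\<close>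
          by (auto simp: bot_pos_rauzy_veech move_last_after_def split: if_splits)
      qed
      ultimately show "top_pos ?S u < top_pos ?S (?w n)" "bot_pos ?S u < bot_pos ?S (?w n)"
        using is_ietD(4,5)[OF S] by (metis injD le_neq_implies_less)+
    qed
    \<comment> \<open>If \<alpha> stood before \<open>u\<close> at time \<open>n2\<close>, it would
      do so forever, because \<open>u\<close> precedes every winner and neither letter is moved. But
      \<alpha> wins again, and then \<open>u\<close> must precede it.\<close>
    have separated: "pos (rv_iter T n2) u < pos (rv_iter T n2) \<alpha>"
      if moves: "\<And>n. pos (rv_iter T (Suc n)) = pos (rv_iter T n) \<or>
          pos (rv_iter T (Suc n)) = move_last_after (pos (rv_iter T n)) (?l n) (?w n)"
        and dom: "\<And>n u. n \<ge> n2 \<Longrightarrow> u \<in> U \<Longrightarrow> pos (rv_iter T n) u < pos (rv_iter T n) (?w n)"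
        and inj: "inj (pos (rv_iter T n2))" and u: "u \<in> U" and \<alpha>: "\<alpha> \<notin> U"
      for pos :: "'a iet \<Rightarrow> 'a \<Rightarrow> nat" and u \<alpha>
    proof (rule ccontr)
      assume "\<not> ?thesis"
      then have less: "pos (rv_iter T n2) \<alpha> < pos (rv_iter T n2) u"
        using inj u \<alpha> by (metis injD linorder_neqE_nat)
      have "pos (rv_iter T n) \<alpha> < pos (rv_iter T n) u" if "n \<ge> n2" for n
        using that
      proof (induction n rule: dec_induct)
        case base
        then show ?case by (rule less)
      next
        case (step n)
        then show ?case
          using moves[of n] dom[of n u] u by (auto simp: move_last_after_def simp del: rv_iter_Suc)
      qed
      moreover obtain n where "n \<ge> n2" "?w n = \<alpha>"
        using \<alpha> unfolding U_def by blast
      ultimately show False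
        using dom[of n u] u by fastforce
    qed
    note S = is_iet_rv_iter[OF K, of n2]
    have "top_pos (rv_iter T n2) -` {1..card U} = U"
    proof (rule initial_segment_vimage[OF is_ietD(1)[OF S]])
      fix u \<alpha> assume "u \<in> U" "\<alpha> \<notin> U"
      then show "top_pos (rv_iter T n2) u < top_pos (rv_iter T n2) \<alpha>"
        by (intro separated[where pos = top_pos] dom(1) is_ietD(4)[OF S]) (auto simp: top_pos_rauzy_veech)
    qed
    moreover have "bot_pos (rv_iter T n2) -` {1..card U} = U"
    proof (rule initial_segment_vimage[OF is_ietD(2)[OF S]])
      fix u \<alpha> assume "u \<in> U" "\<alpha> \<notin> U"
      then show "bot_pos (rv_iter T n2) u < bot_pos (rv_iter T n2) \<alpha>"
        by (intro separated[where pos = bot_pos] dom(2) is_ietD(5)[OF S]) (auto simp: bot_pos_rauzy_veech)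
    qed
    moreover have "card U \<in> {1..CARD('a) - 1}"
    proof -
      have "U \<subset> UNIV"
        using n0[of n0] by blast
      then have "card U < CARD('a)"
        by (intro psubset_card_mono) auto
      then show ?thesis
        using U by (simp add: Suc_le_eq card_gt_0_iff)
    qed
    ultimately show False
      using bspec[OF keane_ietD(3)[OF keane_iet_rv_iter[OF K, of n2], unfolded admissible_def], of "card U"]
      by (simp only: simp_thms True_implies_equals)
  qed
  then show ?thesis unfolding U_def by blast
qed

section \<open>The accelerated times\<close>

lemma winners_between_mono: "n \<le> n' \<Longrightarrow> winners_between T m n \<subseteq> winners_between T m n'"
  by (force simp: winners_between_def)

text \<open>The greatest element exists: a single step has one winner among at least two letters,
  and by time \<open>N\<close> every letter has won. By maximality one further step completes the
  set of winners, whence the \<open>Suc\<close>.\<close>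

lemma mmy_time_Suc:
  assumes K: "keane_iet (T :: 'a::finite iet)"
  shows "mmy_time T k < mmy_time T (Suc k)"
    "winners_between T (mmy_time T k) (Suc (mmy_time T (Suc k))) = UNIV"
proof -
  let ?m = "mmy_time T k"
  let ?P = "\<lambda>n. n > ?m \<and> winners_between T ?m n \<noteq> UNIV"
  obtain g where g: "\<And>\<alpha>. g \<alpha> \<ge> ?m \<and> winner (rv_iter T (g \<alpha>)) = \<alpha>"
    using winner_infinitely_often[OF K] by metis
  define N where "N = Suc (Max (range g))"
  have "g \<alpha> < N" for \<alpha>
    unfolding N_def by (simp add: le_imp_less_Suc)
  then have N: "winners_between T ?m N = UNIV"
    unfolding winners_between_def using g by (auto simp: image_iff) (metis atLeastLessThan_iff)
  have bound: "\<forall>n. ?P n \<longrightarrow> n \<le> N"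
    using N winners_between_mono[of N _ T ?m] by (metis nat_le_linear top.extremum_uniqueI)
  have "winners_between T ?m (Suc ?m) = {winner (rv_iter T ?m)}"
    by (simp add: winners_between_def)
  moreover have "{winner (rv_iter T ?m)} \<noteq> UNIV"
    using keane_ietD(1)[OF K] by (metis card_1_singleton_iff Suc_1 One_nat_def not_less_eq_eq order_refl)
  ultimately have "?P (Suc ?m)"
    by simp
  then have "?P (mmy_time T (Suc k))"
    unfolding mmy_time.simps using bound by (intro GreatestI_ex_nat[of ?P N]) blast+
  then show less: "mmy_time T k < mmy_time T (Suc k)"
    by blast
  show "winners_between T ?m (Suc (mmy_time T (Suc k))) = UNIV"
  proof (rule ccontr)
    assume "\<not> ?thesis"
    then have "?P (Suc (mmy_time T (Suc k)))"
      using less by simp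
    then have "Suc (mmy_time T (Suc k)) \<le> mmy_time T (Suc k)"
      unfolding mmy_time.simps(2) using bound by (intro Greatest_le_nat[of ?P _ N]) blast+
    then show False by simp
  qed
qed

lemma strict_mono_mmy_time: "keane_iet T \<Longrightarrow> strict_mono (mmy_time T)"
  by (simp add: strict_mono_Suc_iff mmy_time_Suc del: mmy_time.simps)

text \<open>The completing step after the first accelerated time lies within the next accelerated
  block, so two blocks see every winner.\<close>

lemma winners_between_mmy_time:
  assumes K: "keane_iet T"
  shows "winners_between T (mmy_time T k) (mmy_time T (k + 2)) = UNIV"
  using mmy_time_Suc(2)[OF K, of k] mmy_time_Suc(1)[OF K, of "Suc k"]
    winners_between_mono[of "Suc (mmy_time T (Suc k))" "mmy_time T (k + 2)" T "mmy_time T k"]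
  by (auto simp: Suc_le_eq simp del: mmy_time.simps)

subsection \<open>Positivity\<close>

text \<open>The winner is last in the order that the step keeps, so it competes again at the next
  step.\<close>

lemma loser_rauzy_veech:
  assumes "winner (rauzy_veech T) \<noteq> winner T"
  shows "loser (rauzy_veech T) = winner T"
proof -
  have "top_type T \<Longrightarrow> last_top (rauzy_veech T) = last_top T"
    "\<not> top_type T \<Longrightarrow> last_bot (rauzy_veech T) = last_bot T"
    by (simp_all add: last_top_def last_bot_def top_pos_rauzy_veech bot_pos_rauzy_veech)
  then show ?thesis
    using assms unfolding winner_def[of T] winner_def[of "rauzy_veech T"] loser_def[of "rauzy_veech T"]
    by (auto split: if_splits)
qed

text \<open>The rows with positive entry in column \<alpha>. The matrices have integer entries, and
  the bound 1 is the form in which positivity is applied.\<close>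

definition support :: "'a::finite iet \<Rightarrow> nat \<Rightarrow> nat \<Rightarrow> 'a \<Rightarrow> 'a set" where
  "support T m n \<alpha> = {\<beta>. Q_mat T m n $ \<beta> $ \<alpha> \<ge> 1}"

lemma support_mono:
  assumes "m \<le> n" "n \<le> n'" shows "support T m n \<alpha> \<subseteq> support T m n' \<alpha>"
  using assms(2)
proof (induction n' rule: dec_induct)
  case (step n')
  have "support T m n' \<alpha> \<subseteq> support T m (Suc n') \<alpha>"
    using assms(1) step.hyps Q_mat_nonneg[of m n' T]
    by (auto simp: support_def Q_mat_Suc_entry add_increasing2 simp del: Q_mat.simps)
  then show ?case using step.IH by blast
qed simp

lemma support_winner:
  assumes "m \<le> n" "winner (rv_iter T n) \<in> support T m n \<alpha>"
  shows "loser (rv_iter T n) \<in> support T m (Suc n) \<alpha>"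
  using assms Q_mat_nonneg[OF assms(1), of T "loser (rv_iter T n)" \<alpha>]
  by (simp add: support_def Q_mat_Suc_entry del: Q_mat.simps)

text \<open>
  Between \<open>i\<close> and \<open>j\<close> the winner changes from a letter outside the support to a letter inside, and
  at this change the new winner beats the old one.
\<close>

lemma support_grows:
  assumes "m \<le> a" "a \<le> i" "i < j" "winner (rv_iter T i) \<notin> support T m a \<alpha>"
    "winner (rv_iter T j) \<in> support T m a \<alpha>"
  shows "support T m a \<alpha> \<subset> support T m (Suc j) \<alpha>"
proof (rule ccontr)
  assume contra: "\<not> ?thesis"
  \<comment> \<open>Supports only grow, so without strict growth up to \<open>Suc j\<close> all
    those in between coincide.\<close>
  have eq: "support T m n \<alpha> = support T m a \<alpha>" if "a \<le> n" "n \<le> Suc j" for n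
    using contra support_mono[OF assms(1) that(1), of T \<alpha>] support_mono[of m n "Suc j" T \<alpha>] assms(1) that
    by auto
  obtain k where k: "i \<le> k" "k < j" "winner (rv_iter T k) \<notin> support T m a \<alpha>"
      "winner (rv_iter T (Suc k)) \<in> support T m a \<alpha>"
  proof (rule ccontr)
    assume no: "\<not> thesis"
    note found = that
    have "n \<le> j \<longrightarrow> winner (rv_iter T n) \<notin> support T m a \<alpha>" if "i \<le> n" for n
      using that
    proof (induction n rule: dec_induct)
      case (step n)
      then show ?case using no found[of n] by (auto simp: Suc_le_eq)
    qed (use assms(4) in simp)
    from this[of j] show False
      using assms(3,5) by simp
  qed
  have "loser (rv_iter T (Suc k)) = winner (rv_iter T k)"
    using k(3,4) by (auto intro!: loser_rauzy_veech)
  moreover have "loser (rv_iter T (Suc k)) \<in> support T m (Suc (Suc k)) \<alpha>"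
    using k assms(1,2) eq[of "Suc k"] by (intro support_winner) auto
  ultimately show False
    using k assms(2) eq[of "Suc (Suc k)"] by simp
qed

text \<open>Before \<open>b\<close> some letter outside the support wins, from \<open>b\<close> on
  some letter inside it: the situation of \<open>support_grows\<close>.\<close>

lemma support_grows_complete:
  assumes "m \<le> a" "a \<le> b" "winners_between T a b = UNIV" "winners_between T b c = UNIV"
    and "support T m a \<alpha> \<noteq> {}" "support T m a \<alpha> \<noteq> UNIV"
  shows "support T m a \<alpha> \<subset> support T m c \<alpha>"
proof -
  obtain \<beta> \<gamma> where "\<beta> \<in> support T m a \<alpha>" "\<gamma> \<notin> support T m a \<alpha>"
    using assms(5,6) by blast
  moreover have "\<beta> \<in> winners_between T b c" "\<gamma> \<in> winners_between T a b"
    using assms(3,4) by auto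
  ultimately obtain i j where ij: "a \<le> i" "i < b" "b \<le> j" "j < c" "winner (rv_iter T i) \<notin> support T m a \<alpha>"
    "winner (rv_iter T j) \<in> support T m a \<alpha>"
    unfolding winners_between_def by auto
  have "support T m a \<alpha> \<subset> support T m (Suc j) \<alpha>"
    using ij assms(1) by (intro support_grows[of m a i]) auto
  also have "\<dots> \<subseteq> support T m c \<alpha>"
    using ij assms(1,2) by (intro support_mono) auto
  finally show ?thesis .
qed

lemma mmy_time_mono: "keane_iet T \<Longrightarrow> k \<le> l \<Longrightarrow> mmy_time T k \<le> mmy_time T l"
  using strict_mono_mmy_time strict_mono_less_eq by blast

text \<open>Two accelerated blocks see every winner, so four provide the two complete stretches that
  add a letter to the support until it is full.\<close>

lemma card_support_ge:
  assumes K: "keane_iet (T :: 'a::finite iet)"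
  shows "min CARD('a) (Suc j) \<le> card (support T (mmy_time T k) (mmy_time T (k + 4 * j)) \<alpha>)"
proof (induction j)
  case 0
  have "\<alpha> \<in> support T (mmy_time T k) (mmy_time T k) \<alpha>"
    by (simp add: support_def mat_def)
  then have "card (support T (mmy_time T k) (mmy_time T k) \<alpha>) > 0"
    by (auto simp: card_gt_0_iff)
  then show ?case by simp
next
  case (Suc j)
  let ?m = "mmy_time T k" and ?a = "mmy_time T (k + 4 * j)"
  let ?c = "mmy_time T (k + 4 * Suc j)"
  let ?R = "support T ?m ?a \<alpha>" and ?R' = "support T ?m ?c \<alpha>"
  have le: "?m \<le> ?a" "?a \<le> ?c"
    by (simp_all add: mmy_time_mono[OF K] del: mmy_time.simps)
  have "?R \<noteq> {}"
    using Suc.IH by (auto simp: min_def split: if_splits)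
  show ?case
  proof (cases "?R = UNIV")
    case True
    then have "?R' = UNIV"
      using support_mono[OF le, of T \<alpha>] by auto
    then show ?thesis by simp
  next
    case False
    have "?R \<subset> ?R'"
    proof (rule support_grows_complete[OF le(1)])
      show "?a \<le> mmy_time T (k + 4 * j + 2)"
        by (simp add: mmy_time_mono[OF K] del: mmy_time.simps)
      show "winners_between T ?a (mmy_time T (k + 4 * j + 2)) = UNIV"
        by (rule winners_between_mmy_time[OF K])
      show "winners_between T (mmy_time T (k + 4 * j + 2)) ?c = UNIV"
        using winners_between_mmy_time[OF K, of "k + 4 * j + 2"]
        by (simp add: numeral_eq_Suc del: mmy_time.simps)
    qed fact+
    then have "card ?R < card ?R'"
      by (intro psubset_card_mono) auto
    then show ?thesis using Suc.IH by linarith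
  qed
qed

lemma Q_mat_mmy_ge_1:
  assumes K: "keane_iet (T :: 'a::finite iet)"
  shows "Q_mat T (mmy_time T k) (mmy_time T (k + 4 * CARD('a))) $ \<beta> $ \<alpha> \<ge> 1"
proof -
  let ?R = "support T (mmy_time T k) (mmy_time T (k + 4 * CARD('a))) \<alpha>"
  have "CARD('a) \<le> card ?R"
    using card_support_ge[OF K, of "CARD('a)" k \<alpha>] by simp
  then have "?R = UNIV"
    by (intro card_seteq) auto
  then show ?thesis unfolding support_def by blast
qed

section \<open>Growth of total heights under Condition (A)\<close>

lemma total_height_power_growth:
  assumes K: "keane_iet T" and A: "condition_A T" and "\<epsilon> > 0"
  shows "\<exists>C>0. \<forall>k\<ge>1. total_height T (mmy_time T (k + s))
    \<le> C * total_height T (mmy_time T k) powr (1 + \<epsilon>)"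
  using assms(3)
proof (induction s arbitrary: \<epsilon>)
  case 0
  have "x \<le> 1 * x powr (1 + \<epsilon>)" if "x \<ge> 1" for x :: real
    using powr_mono[of 1 "1 + \<epsilon>" x] that 0 by simp
  moreover have "total_height T n \<ge> 1" for n
    using total_height_ge[of n T] by simp
  ultimately show ?case
    by (intro exI[of _ 1]) simp
next
  case (Suc s)
  let ?H = "\<lambda>k. total_height T (mmy_time T k)"
  have H: "?H k \<ge> 1" for k
    using total_height_ge[of "mmy_time T k" T] by simp
  \<comment> \<open>One factor \<open>1 + \<delta>\<close> comes from the induction hypothesis, the
    other from Condition (A). As \<delta> is at most 1, its square is at most \<delta>, and the
    product is at most \<open>1 + 3 * \<delta>\<close>.\<close>
  define \<delta> where "\<delta> = min 1 (\<epsilon> / 3)"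
  have \<delta>: "\<delta> > 0" "(1 + \<delta>) * (1 + \<delta>) \<le> 1 + \<epsilon>"
  proof -
    show "\<delta> > 0" using Suc.prems by (simp add: \<delta>_def)
    moreover have "\<delta> \<le> 1" "3 * \<delta> \<le> \<epsilon>"
      by (auto simp: \<delta>_def)
    moreover from calculation have "\<delta> * \<delta> \<le> \<delta>"
      using mult_left_mono[of \<delta> 1 \<delta>] by simp
    ultimately show "(1 + \<delta>) * (1 + \<delta>) \<le> 1 + \<epsilon>"
      unfolding distrib_left distrib_right by linarith
  qed
  obtain C where C: "C > 0" "\<And>k. k \<ge> 1 \<Longrightarrow> ?H (k + s) \<le> C * ?H k powr (1 + \<delta>)"
    using Suc.IH[OF \<delta>(1)] by blast
  obtain C' where C': "C' > 0"
    "\<And>k. k \<ge> 1 \<Longrightarrow> matrix_norm1 (A_mat T k (k + 1)) \<le> C' * ?H k powr \<delta>"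
    using A \<delta>(1) unfolding condition_A_def matrix_norm1_Q_mat_0 by blast
  have "?H (k + Suc s) \<le> (C' * C powr (1 + \<delta>)) * ?H k powr (1 + \<epsilon>)" if "k \<ge> 1" for k
  proof -
    have "?H (k + Suc s) \<le> matrix_norm1 (A_mat T (k + s) (k + s + 1)) * ?H (k + s)"
      unfolding A_mat_def using total_height_le_mult[OF mmy_time_mono[OF K, of "k + s" "k + s + 1"]]
      by (simp del: mmy_time.simps)
    also have "\<dots> \<le> (C' * ?H (k + s) powr \<delta>) * ?H (k + s)"
      using C'(2)[of "k + s"] that H[of "k + s"] by (intro mult_right_mono) auto
    also have "\<dots> = C' * ?H (k + s) powr (1 + \<delta>)"
      using H[of "k + s"] by (simp add: powr_add)
    also have "\<dots> \<le> C' * (C * ?H k powr (1 + \<delta>)) powr (1 + \<delta>)"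
      using C(2)[OF that] C'(1) H[of "k + s"] \<delta>(1) by (intro mult_left_mono powr_mono2) auto
    also have "\<dots> = C' * C powr (1 + \<delta>) * ?H k powr ((1 + \<delta>) * (1 + \<delta>))"
      using C(1) by (simp add: powr_mult powr_powr)
    also have "\<dots> \<le> C' * C powr (1 + \<delta>) * ?H k powr (1 + \<epsilon>)"
      using C'(1) \<delta>(2) H[of k] by (intro mult_left_mono powr_mono) auto
    finally show ?thesis .
  qed
  then show ?case
    using C(1) C'(1) by (intro exI[of _ "C' * C powr (1 + \<delta>)"]) auto
qed

section \<open>Delays of the discontinuities and the final estimate\<close>

lemma top_pos_rv_iter_first:
  "keane_iet T \<Longrightarrow> top_pos (rv_iter T n) \<alpha> = 1 \<longleftrightarrow> top_pos T \<alpha> = 1"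
proof (induction n)
  case (Suc n)
  then show ?case using top_pos_rauzy_veech_first[OF keane_iet_rv_iter, of T n \<alpha>] by simp
qed simp

text \<open>An unmoved left end would lie to the right of the first interval at time
  \<open>m\<close>, hence outside the domain at time \<open>n\<close>. So it has moved, which forces
  a large delay.\<close>

lemma delay_ge:
  assumes K: "keane_iet (T :: 'a::finite iet)" and "m \<le> n" and "top_pos T \<alpha> > 1"
    and len: "\<And>\<gamma>. total_length (rv_iter T n) \<le> len (rv_iter T m) \<gamma>"
  shows "\<exists>\<gamma>. height T m \<gamma> \<le> delay T n \<alpha>"
proof -
  note S = is_iet_rv_iter[OF K, of m] and S' = is_iet_rv_iter[OF K, of n]
  have "1 \<in> range (top_pos (rv_iter T m))"
    using is_ietD(1)[OF S] by (simp add: bij_betw_def Suc_leI)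
  then obtain \<gamma> where \<gamma>: "top_pos (rv_iter T m) \<gamma> = 1"
    by (metis imageE)
  have "top_pos (rv_iter T m) \<alpha> \<noteq> 1"
    using top_pos_rv_iter_first[OF K, of m \<alpha>] assms(3) by simp
  then have "top_pos (rv_iter T m) \<gamma> < top_pos (rv_iter T m) \<alpha>"
    using position_bounds(1)[OF is_ietD(1)[OF S], of \<alpha>] \<gamma> by simp
  then have "left_end (rv_iter T m) \<gamma> + len (rv_iter T m) \<gamma> \<le> left_end (rv_iter T m) \<alpha>"
    unfolding left_end_offset by (intro offset_less is_ietD[OF S])
  moreover have "left_end (rv_iter T m) \<gamma> \<ge> 0"
    using left_end_in_domain[OF S] by (simp add: iet_domain_def)
  moreover have "left_end (rv_iter T n) \<alpha> < total_length (rv_iter T n)"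
    using left_end_in_domain[OF S'] by (simp add: iet_domain_def)
  ultimately have "left_end (rv_iter T n) \<alpha> \<noteq> left_end (rv_iter T m) \<alpha>"
    using len[of \<gamma>] by linarith
  then show ?thesis
    using left_end_stable_or_delay_ge[OF K assms(2)] by blast
qed

lemma min_gap_ge_inverse_total_height:
  assumes K: "keane_iet (T :: 'a::finite iet)" and "total_length T = 1"
    and n: "real n \<le> total_height T (mmy_time T k)"
  shows "1 / total_height T (mmy_time T (k + 12 * CARD('a))) \<le> min_gap T n"
proof -
  let ?r = "4 * CARD('a)"
  \<comment> \<open>Three positive blocks: up to \<open>N 1\<close> the heights become large, up to
    \<open>N 2\<close> the delays, and the block up to \<open>N 3\<close> bounds the lengths at
    \<open>N 2\<close> from below.\<close>
  define N where "N i = mmy_time T (k + i * ?r)" for i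
  have le: "N i \<le> N (Suc i)" for i
    unfolding N_def by (simp add: mmy_time_mono[OF K] del: mmy_time.simps)
  have Q: "Q_mat T (N i) (N (Suc i)) $ \<beta> $ \<gamma> \<ge> 1" for i \<beta> \<gamma>
    using Q_mat_mmy_ge_1[OF K, of "k + i * ?r"]
    by (simp add: N_def algebra_simps del: mmy_time.simps Q_mat.simps)
  note len = len_ge_total_length[OF K le Q]
  have N3: "N 3 = mmy_time T (k + 12 * CARD('a))" and N0: "N 0 = mmy_time T k"
    by (simp_all add: N_def del: mmy_time.simps)
  show ?thesis
  proof (rule min_gap_ge[OF K assms(2), where n = "N 2"])
    fix \<alpha> assume "top_pos T \<alpha> > 1"
    then obtain \<gamma> where "height T (N 1) \<gamma> \<le> delay T (N 2) \<alpha>"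
      using delay_ge[OF K le[of 1], of \<alpha>] len[of 1] by (auto simp: numeral_2_eq_2)
    moreover have "real n \<le> real (height T (N 1) \<gamma>)"
      using n height_ge_total_height[OF le Q, of 0 \<gamma>] by (simp add: N0)
    ultimately show "n \<le> Suc (delay T (N 2) \<alpha>)"
      by simp
  next
    fix \<gamma>
    have "1 \<le> total_length (rv_iter T (N 3)) * total_height T (N 3)"
      using total_length_le_mult[OF K, of "N 3"] assms(2) by simp
    then have "1 / total_height T (N 3) \<le> total_length (rv_iter T (N 3))"
      using total_height_ge[of "N 3" T] by (simp add: divide_le_eq)
    also have "\<dots> \<le> len (rv_iter T (N 2)) \<gamma>"
      using len[of 2 \<gamma>] by (simp add: numeral_3_eq_3 numeral_2_eq_2)
    finally show "1 / total_height T (mmy_time T (k + 12 * CARD('a))) \<le> len (rv_iter T (N 2)) \<gamma>"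
      by (simp only: N3)
  qed
qed

theorem theorem4p5:
  fixes T :: "'a::finite iet"
  assumes "CARD('a) \<ge> 2"
    and "is_iet T" and "admissible T" and "keane T"
    and "total_length T = 1"
    and "condition_A T"
  shows "condition_D T"
  unfolding condition_D_def
proof (intro allI impI)
  fix \<epsilon> :: real assume "\<epsilon> > 0"
  have K: "keane_iet T"
    using assms by (simp add: keane_iet_def)
  let ?H = "\<lambda>k. total_height T (mmy_time T k)"
  \<comment> \<open>\<open>12 * CARD('a)\<close> for the three positive blocks, and 1 more because
    the growth estimate starts at \<open>k - 1\<close>.\<close>
  let ?s = "12 * CARD('a) + 1"
  have H1: "?H k \<ge> 1" for k
    using total_height_ge[of "mmy_time T k" T] by simp
  obtain C where C: "C > 0" "\<And>k. k \<ge> 1 \<Longrightarrow> ?H (k + ?s) \<le> C * ?H k powr (1 + \<epsilon>)"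
    using total_height_power_growth[OF K assms(6) \<open>\<epsilon> > 0\<close>] by blast
  \<comment> \<open>The second entry covers \<open>k \<le> 1\<close>, where the growth estimate
    cannot be started at \<open>k - 1\<close>.\<close>
  define D where "D = max C (?H ?s)"
  have "D > 0"
    using C(1) by (simp add: D_def)
  have "min_gap T n \<ge> 1 / D * real n powr - (1 + \<epsilon>)" if "n \<ge> 1" for n
  proof -
    \<comment> \<open>The accelerated times increase strictly, so \<open>n\<close> itself is a
      candidate and the least \<open>k\<close> exists.\<close>
    have "real n \<le> ?H n"
      using total_height_ge[of "mmy_time T n" T] strict_mono_imp_increasing[OF strict_mono_mmy_time[OF K], of n]
      by linarith
    define k where "k = (LEAST k. real n \<le> ?H k)"
    have k: "real n \<le> ?H k"
      unfolding k_def by (rule LeastI) fact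
    have "?H (k + 12 * CARD('a)) \<le> D * real n powr (1 + \<epsilon>)"
    proof (cases "k \<le> 1")
      case True
      have "?H (k + 12 * CARD('a)) \<le> ?H ?s"
        using True by (intro total_height_mono mmy_time_mono[OF K]) simp
      also have "\<dots> \<le> D * 1"
        by (simp add: D_def)
      also have "\<dots> \<le> D * real n powr (1 + \<epsilon>)"
        using \<open>D > 0\<close> that \<open>\<epsilon> > 0\<close> by (intro mult_left_mono ge_one_powr_ge_zero) auto
      finally show ?thesis .
    next
      case False
      then have less: "?H (k - 1) < real n"
        using not_less_Least[of "k - 1" "\<lambda>k. real n \<le> ?H k"] by (simp add: k_def)
      have "?H (k + 12 * CARD('a)) = ?H (k - 1 + ?s)"
        using False by (simp del: mmy_time.simps)
      also have "\<dots> \<le> C * ?H (k - 1) powr (1 + \<epsilon>)"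
        using False by (intro C(2)) simp
      also have "\<dots> \<le> D * real n powr (1 + \<epsilon>)"
        using less H1[of "k - 1"] \<open>D > 0\<close> \<open>\<epsilon> > 0\<close>
        by (intro mult_mono powr_mono2) (auto simp: D_def)
      finally show ?thesis .
    qed
    then have "1 / (D * real n powr (1 + \<epsilon>)) \<le> 1 / ?H (k + 12 * CARD('a))"
      using H1[of "k + 12 * CARD('a)"] by (intro divide_left_mono) auto
    also have "\<dots> \<le> min_gap T n"
      by (rule min_gap_ge_inverse_total_height[OF K assms(5) k])
    finally show ?thesis
      unfolding powr_minus_divide by simp
  qed
  then show "\<exists>C>0. \<forall>n\<ge>1. min_gap T n \<ge> C * real n powr - (1 + \<epsilon>)"
    using \<open>D > 0\<close> by (intro exI[of _ "1 / D"]) simp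
qed

end
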